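(* Let $K$ be a field of characteristic $p>0$ and let $\mathcal{D}(P_n)$ be the ring of differential operators on $P_n=K[x_1,\ldots,x_n]$. For each $\sigma\in\operatorname{Aut}_K(\mathcal{D}(P_n))$ and each $a\in\mathcal{D}(P_n)$, $$\sigma^{-1}(a)=\sum_{\alpha,\beta\in\mathbb{N}^n}(-1)^{|\alpha|}\phi_\sigma\big({\delta'}^{\beta}(a)\,{\partial'}^{[\alpha]}\big)\,\partial^{[\beta]}x^\alpha=\sum_{\alpha,\beta\in\mathbb{N}^n}\psi_\sigma\big({\partial'}^{[\alpha]}\,{\delta'}^{\beta}(a)\big)\,x^\alpha\partial^{[\beta]},$$ where ${\delta'}^\beta:=\prod_{i=1}^n(-\operatorname{ad}x_i')^{\beta_i}$, $x_i':=\sigma(x_i)$, and ${\partial'}^{[\alpha]}$, $\phi_\sigma$, $\psi_\sigma$ are defined in the context.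
   Context: $\mathbb{N}=\{0,1,\ldots\}$, $|\alpha|=\alpha_1+\cdots+\alpha_n$, $(\operatorname{ad}r)(s)=[r,s]=rs-sr$. The $K$-algebra $\mathcal{D}:=\mathcal{D}(P_n)$ is generated by $x_1,\ldots,x_n$ and the higher derivations $\partial_i^{[k]}$ (formally $\partial_i^k/k!$), $1\le i\le n$, $k\ge1$, with defining relations $[x_i,x_j]=[\partial_i^{[k]},\partial_j^{[l]}]=0$, $\partial_i^{[k]}\partial_i^{[l]}=\binom{k+l}{k}\partial_i^{[k+l]}$, $[\partial_i^{[k]},x_j]=\delta_{ij}\partial_i^{[k-1]}$ ($\delta_{ij}$ the Kronecker delta, $\partial_i^{[0]}:=1$). Put $x^\alpha=\prod_ix_i^{\alpha_i}$ and $\partial^{[\beta]}=\prod_i\partial_i^{[\beta_i]}$; $\{x^\alpha\partial^{[\beta]}\}$ and $\{\partial^{[\beta]}x^\alpha\}$ are $K$-bases of $\mathcal{D}$. Given $\sigma$, put $x_i':=\sigma(x_i)$, ${\partial_i'}^{[k]}:=\sigma(\partial_i^{[k]})$, ${\partial'}^{[\alpha]}:=\prod_i{\partial_i'}^{[\alpha_i]}$, $P_n':=K[x_1',\ldots,x_n']$. For $1\le i\le n$ define $K$-linear maps $\mathcal{D}\to\mathcal{D}$ (finite sums on each element) $$\phi_i':=\sum_{k\ge0}{\partial_i'}^{[k]}(\operatorname{ad}x_i')^k,\qquad \psi_i':=\sum_{k\ge0}(\operatorname{ad}x_i')^k(\cdot)\,{\partial_i'}^{[k]}.$$ The products $\phi_n'\cdots\phi_1'$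 and $\psi_1'\cdots\psi_n'$ have image $P_n'$. Further, for $1\le i\le n$ let $$\phi_{n+i}':=\cdots\phi_{n+i,1}'\phi_{n+i,0}':P_n'\to P_n',\qquad \phi_{n+i,k}':=\sum_{j=0}^{p-1}(-1)^j\frac{{x_i'}^{p^kj}}{j!}\big(\operatorname{ad}{\partial_i'}^{[p^k]}\big)^j ,$$ where $\phi_{n+i,k}'$ acts on the polynomials in $P_n'$ that involve $x_i'$ only through ${x_i'}^{p^k}$ (it maps these to polynomials involving $x_i'$ only through ${x_i'}^{p^{k+1}}$), and on each element of $P_n'$ all but finitely many factors act as the identity. Finally $$\phi_\sigma:=\phi_{2n}'\cdots\phi_{n+1}'\phi_n'\cdots\phi_1',\qquad \psi_\sigma:=\phi_{2n}'\cdots\phi_{n+1}'\psi_1'\cdots\psi_n' .$$ *)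

theory Defs
  imports Complex_Main "HOL-Library.Poly_Mapping"
begin

section \<open>The polynomial algebra\<close>

text \<open>
  \<open>P\<^sub>n = K[x\<^sub>1, \<dots>, x\<^sub>n]\<close>. The indices \<open>1 < \<dots> < n\<close> are the elements of the finite
  linearly ordered type \<open>'n\<close>.
\<close>

type_synonym ('n, 'k) mpoly = "('n \<Rightarrow>\<^sub>0 nat) \<Rightarrow>\<^sub>0 'k"

definition poly_scale :: "'k::field \<Rightarrow> ('n, 'k) mpoly \<Rightarrow> ('n, 'k) mpoly" where
  "poly_scale c p = Poly_Mapping.single 0 c * p"

definition poly_var :: "'n \<Rightarrow> ('n, 'k::field) mpoly" where
  "poly_var i = Poly_Mapping.single (Poly_Mapping.single i 1) 1"

text \<open>
  \<open>\<partial>\<^sub>i\<^bsup>[k]\<^esup> (x\<^sup>m) = (m\<^sub>i choose k) x\<^bsup>m - k e\<^sub>i\<^esup>\<close>, extended linearly. The truncated subtraction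
  is harmless because the coefficient vanishes for \<open>m\<^sub>i < k\<close>.
\<close>

definition hasse_deriv :: "'n \<Rightarrow> nat \<Rightarrow> ('n, 'k::field) mpoly \<Rightarrow> ('n, 'k) mpoly" where
  "hasse_deriv i k p = (\<Sum>m \<in> Poly_Mapping.keys p.
     Poly_Mapping.single (m - Poly_Mapping.single i k)
       (of_nat (Poly_Mapping.lookup m i choose k) * Poly_Mapping.lookup p m))"

lemma poly_scale_vector_space:
  "vector_space (poly_scale :: 'k::field \<Rightarrow> ('n, 'k) mpoly \<Rightarrow> ('n, 'k) mpoly)"
proof (rule vector_space.intro)
  show "poly_scale a (poly_scale b x) = poly_scale (a * b) x" for a b and x :: "('n, 'k) mpoly"
    by (simp add: poly_scale_def mult_single flip: mult.assoc)
qed (simp_all add: poly_scale_def distrib_left distrib_right single_add)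

lemma mpoly_sum_monomials:
  fixes p :: "('n, 'k::field) mpoly"
  shows "p = (\<Sum>m \<in> Poly_Mapping.keys p. Poly_Mapping.single m (Poly_Mapping.lookup p m))"
  by (rule poly_mapping_eqI) (auto simp: lookup_sum lookup_single when_def sum.delta in_keys_iff)

lemma hasse_deriv_superset:
  assumes "finite A" "Poly_Mapping.keys p \<subseteq> A"
  shows "hasse_deriv i k p = (\<Sum>m \<in> A. Poly_Mapping.single (m - Poly_Mapping.single i k)
       (of_nat (Poly_Mapping.lookup m i choose k) * Poly_Mapping.lookup p m))"
  unfolding hasse_deriv_def
  by (rule sum.mono_neutral_left) (use assms in \<open>auto simp: in_keys_iff\<close>)

lemma hasse_deriv_add: "hasse_deriv i k (p + q) = hasse_deriv i k p + hasse_deriv i k q"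
proof -
  let ?A = "Poly_Mapping.keys p \<union> Poly_Mapping.keys q"
  have "Poly_Mapping.keys (p + q) \<subseteq> ?A" by (rule keys_add)
  then show ?thesis
    by (simp add: hasse_deriv_superset[of ?A] lookup_add distrib_left single_add sum.distrib)
qed

lemma hasse_deriv_single:
  "hasse_deriv i k (Poly_Mapping.single m c) =
     Poly_Mapping.single (m - Poly_Mapping.single i k) (of_nat (Poly_Mapping.lookup m i choose k) * c)"
  by (simp add: hasse_deriv_superset[of "{m}"])

lemma hasse_deriv_0 [simp]: "hasse_deriv i 0 p = p"
  by (subst (2) mpoly_sum_monomials) (simp add: hasse_deriv_def)

lemma hasse_deriv_zero [simp]: "hasse_deriv i k 0 = 0"
  by (simp add: hasse_deriv_def)

lemma hasse_deriv_sum: "hasse_deriv i k (sum f A) = (\<Sum>a\<in>A. hasse_deriv i k (f a))"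
  by (induction A rule: infinite_finite_induct) (auto simp: hasse_deriv_add)

lemma additive_eq_on_monomials:
  fixes f g :: "('n, 'k::field) mpoly \<Rightarrow> ('n, 'k) mpoly"
  assumes f: "\<And>p q. f (p + q) = f p + f q" and g: "\<And>p q. g (p + q) = g p + g q"
    and eq: "\<And>m c. f (Poly_Mapping.single m c) = g (Poly_Mapping.single m c)"
  shows "f p = g p"
proof -
  have "f 0 = 0" "g 0 = 0" using f[of 0 0] g[of 0 0] by simp_all
  then have *: "f (sum h A) = (\<Sum>a\<in>A. f (h a))" "g (sum h A) = (\<Sum>a\<in>A. g (h a))"
    for h and A :: "('n \<Rightarrow>\<^sub>0 nat) set"
    by (induction A rule: infinite_finite_induct; simp add: f g)+
  show ?thesis by (subst (1 2) mpoly_sum_monomials) (simp only: * eq)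
qed

lemma hasse_deriv_leibniz:
  fixes p q :: "('n, 'k::field) mpoly"
  shows "hasse_deriv i k (p * q) = (\<Sum>a\<le>k. hasse_deriv i a p * hasse_deriv i (k - a) q)"
proof (rule additive_eq_on_monomials[of _ _ p])
  fix m and c :: 'k
  show "hasse_deriv i k (Poly_Mapping.single m c * q) =
      (\<Sum>a\<le>k. hasse_deriv i a (Poly_Mapping.single m c) * hasse_deriv i (k - a) q)"
  proof (rule additive_eq_on_monomials[of _ _ q])
    fix l and d :: 'k
    have "hasse_deriv i a (Poly_Mapping.single m c) * hasse_deriv i (k - a) (Poly_Mapping.single l d)
        = Poly_Mapping.single (m + l - Poly_Mapping.single i k)
            (of_nat ((Poly_Mapping.lookup m i choose a) * (Poly_Mapping.lookup l i choose (k - a))) * (c * d))"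
      if "a \<le> k" for a
    proof (cases "a \<le> Poly_Mapping.lookup m i \<and> k - a \<le> Poly_Mapping.lookup l i")
      case True
      then have "m - Poly_Mapping.single i a + (l - Poly_Mapping.single i (k - a))
          = m + l - Poly_Mapping.single i k"
        using that
        by (intro poly_mapping_eqI) (auto simp: lookup_add lookup_minus lookup_single when_def)
      then show ?thesis by (simp add: hasse_deriv_single mult_single mult_ac)
    next
      case False
      then show ?thesis by (auto simp: hasse_deriv_single binomial_eq_0)
    qed
    moreover have "Poly_Mapping.single t (\<Sum>a\<le>k. h a) = (\<Sum>a\<le>k. Poly_Mapping.single t (h a))"
      for t :: "'n \<Rightarrow>\<^sub>0 nat" and h :: "nat \<Rightarrow> 'k"
      by (induction k) (simp_all add: single_add)
    ultimately have "(\<Sum>a\<le>k. hasse_deriv i a (Poly_Mapping.single m c) * hasse_deriv i (k - a) (Poly_Mapping.single l d))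
        = Poly_Mapping.single (m + l - Poly_Mapping.single i k)
            (of_nat (\<Sum>a\<le>k. (Poly_Mapping.lookup m i choose a) * (Poly_Mapping.lookup l i choose (k - a))) * (c * d))"
      by (simp add: sum_distrib_right)
    then show "hasse_deriv i k (Poly_Mapping.single m c * Poly_Mapping.single l d) =
      (\<Sum>a\<le>k. hasse_deriv i a (Poly_Mapping.single m c) * hasse_deriv i (k - a) (Poly_Mapping.single l d))"
      by (simp only: vandermonde mult_single hasse_deriv_single lookup_add)
  qed (simp_all add: hasse_deriv_add distrib_left sum.distrib)
qed (simp_all add: hasse_deriv_add distrib_right sum.distrib)


section \<open>The ring of differential operators\<close>

text \<open>
  The order filtration of the \<open>K\<close>-linear endomorphisms of \<open>P\<^sub>n\<close>, shifted by one so that it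
  starts with \<open>\<D>\<^bsub>-1\<^esub> = 0\<close>: \<open>f\<close> has order at most \<open>m\<close> iff \<open>[f, p]\<close> has order at most \<open>m - 1\<close> for
  every \<open>p \<in> P\<^sub>n\<close>, acting by multiplication; \<open>diffop_below m\<close> is order at most \<open>m - 1\<close>.
\<close>

primrec diffop_below :: "nat \<Rightarrow> (('n, 'k::field) mpoly \<Rightarrow> ('n, 'k) mpoly) \<Rightarrow> bool" where
  "diffop_below 0 f \<longleftrightarrow> f = (\<lambda>_. 0)"
| "diffop_below (Suc m) f \<longleftrightarrow> Vector_Spaces.linear poly_scale poly_scale f \<and>
     (\<forall>p. diffop_below m (\<lambda>q. f (p * q) - p * f q))"

lemma poly_linear_iff:
  fixes f :: "('n, 'k::field) mpoly \<Rightarrow> ('n, 'k) mpoly"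
  shows "Vector_Spaces.linear poly_scale poly_scale f \<longleftrightarrow>
    (\<forall>p q. f (p + q) = f p + f q) \<and> (\<forall>c p. f (poly_scale c p) = poly_scale c (f p))"
  by (simp only: module_hom_iff_linear[symmetric] module_hom_iff module_iff_vector_space
      poly_scale_vector_space simp_thms)

lemma diffop_below_linear:
  assumes "diffop_below m f"
  shows "Vector_Spaces.linear poly_scale poly_scale f"
  using assms by (cases m) (auto simp: poly_linear_iff poly_scale_def)

lemma diffop_below_simps:
  assumes "diffop_below m f"
  shows "f (p + q) = f p + f q" "f (poly_scale c p) = poly_scale c (f p)"
    "f 0 = 0" "f (- p) = - f p" "f (p - q) = f p - f q"
proof -
  show add: "f (p + q) = f p + f q" and "f (poly_scale c p) = poly_scale c (f p)" for p q c
    using diffop_below_linear[OF assms] by (auto simp: poly_linear_iff)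
  show 0: "f 0 = 0" using add[of 0 0] by simp
  show minus: "f (- p) = - f p" for p using add[of p "- p"] by (simp add: 0 minus_unique)
  show "f (p - q) = f p - f q" using add[of p "- q"] by (simp add: minus)
qed

lemma diffop_below_zero: "diffop_below m (\<lambda>_. 0)"
  by (induction m) (auto simp: poly_linear_iff poly_scale_def)

lemma diffop_below_add:
  "diffop_below m f \<Longrightarrow> diffop_below m g \<Longrightarrow> diffop_below m (\<lambda>q. f q + g q)"
proof (induction m arbitrary: f g)
  case (Suc m)
  have "(\<lambda>q. f (p * q) + g (p * q) - p * (f q + g q)) =
      (\<lambda>q. (f (p * q) - p * f q) + (g (p * q) - p * g q))" for p
    by (auto simp: algebra_simps)
  moreover have "Vector_Spaces.linear poly_scale poly_scale (\<lambda>q. f q + g q)"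
    using Suc.prems by (auto simp: poly_linear_iff poly_scale_def algebra_simps)
  ultimately show ?case using Suc by simp
qed simp

lemma diffop_below_mult:
  "diffop_below m f \<Longrightarrow> diffop_below m (\<lambda>q. r * f q)"
proof (induction m arbitrary: f)
  case (Suc m)
  have "(\<lambda>q. r * f (p * q) - p * (r * f q)) = (\<lambda>q. r * (f (p * q) - p * f q))" for p
    by (auto simp: algebra_simps)
  moreover have "Vector_Spaces.linear poly_scale poly_scale (\<lambda>q. r * f q)"
    using Suc.prems by (auto simp: poly_linear_iff poly_scale_def algebra_simps)
  ultimately show ?case using Suc by simp
qed simp

lemma diffop_below_sum:
  "(\<And>a. a \<in> A \<Longrightarrow> diffop_below m (f a)) \<Longrightarrow> diffop_below m (\<lambda>q. \<Sum>a\<in>A. f a q)"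
  by (induction A rule: infinite_finite_induct) (auto simp: diffop_below_zero diffop_below_add)

lemma diffop_below_Suc: "diffop_below m f \<Longrightarrow> diffop_below (Suc m) f"
proof (induction m arbitrary: f)
  case (Suc m)
  then have "diffop_below (Suc m) (\<lambda>q. f (p * q) - p * f q)" for p
    using diffop_below.simps(2) by blast
  then show ?case
    using diffop_below_linear[OF Suc.prems] diffop_below.simps(2) by blast
qed (auto simp: poly_linear_iff poly_scale_def)

lemma diffop_below_mono: "m \<le> l \<Longrightarrow> diffop_below m f \<Longrightarrow> diffop_below l f"
  by (induction l rule: dec_induct) (auto simp del: diffop_below.simps intro: diffop_below_Suc)

lemma diffop_below_comp:
  "diffop_below m f \<Longrightarrow> diffop_below l g \<Longrightarrow> diffop_below (m + l) (\<lambda>q. f (g q))"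
proof (induction "m + l" arbitrary: m l f g rule: less_induct)
  case less
  note fl = diffop_below_simps[OF less.prems(1)] and gl = diffop_below_simps[OF less.prems(2)]
  show ?case
  proof (cases "m = 0 \<or> l = 0")
    case True
    then have "(\<lambda>q. f (g q)) = (\<lambda>_. 0)" using less.prems fl(3) by auto
    then show ?thesis by (simp add: diffop_below_zero)
  next
    case False
    then obtain m' l' where ml: "m = Suc m'" "l = Suc l'" by (meson not0_implies_Suc)
    have "diffop_below (m' + l) (\<lambda>q. f (g (p * q)) - p * f (g q))" for p
    proof -
      have "diffop_below (m + l') (\<lambda>q. f (g (p * q) - p * g q))"
        using less.hyps[of m l' f] less.prems ml by auto
      moreover have "diffop_below (m' + l) (\<lambda>q. f (p * g q) - p * f (g q))"
        using less.hyps[of m' l "\<lambda>q. f (p * q) - p * f q" g] less.prems ml by auto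
      ultimately have "diffop_below (m' + l)
          (\<lambda>q. f (g (p * q) - p * g q) + (f (p * g q) - p * f (g q)))"
        using ml by (intro diffop_below_add) auto
      then show ?thesis by (simp add: fl)
    qed
    then show ?thesis using ml by (simp add: poly_linear_iff fl gl)
  qed
qed

lemma diffop_below_poly: "diffop_below (Suc 0) ((*) p)"
  by (auto simp: poly_linear_iff poly_scale_def algebra_simps)

lemma diffop_below_hasse_deriv:
  "diffop_below (Suc k) (hasse_deriv i k :: ('n, 'k::field) mpoly \<Rightarrow> ('n, 'k) mpoly)"
proof (induction k rule: less_induct)
  case (less k)
  have "diffop_below k (\<lambda>q. hasse_deriv i k (p * q) - p * hasse_deriv i k q)"
    for p :: "('n, 'k) mpoly"
  proof -
    have "(\<lambda>q. hasse_deriv i k (p * q) - p * hasse_deriv i k q) =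
        (\<lambda>q. \<Sum>a\<in>{..k} - {0}. hasse_deriv i a p * hasse_deriv i (k - a) q)"
      by (simp add: hasse_deriv_leibniz sum.remove[of "{..k}" 0])
    moreover have "diffop_below k \<dots>"
    proof (intro diffop_below_sum diffop_below_mult)
      fix a assume "a \<in> {..k} - {0}"
      then have "Suc (k - a) \<le> k" "k - a < k" by auto
      then show "diffop_below k (hasse_deriv i (k - a) :: ('n, 'k) mpoly \<Rightarrow> ('n, 'k) mpoly)"
        by (rule diffop_below_mono[OF _ less])
    qed
    ultimately show ?thesis by metis
  qed
  moreover have "hasse_deriv i k (poly_scale c p) = poly_scale c (hasse_deriv i k p)"
    for c and p :: "('n, 'k) mpoly"
    unfolding poly_scale_def
    by (rule additive_eq_on_monomials[of _ _ p])
      (simp_all add: hasse_deriv_add distrib_left mult_single hasse_deriv_single mult.left_commute)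
  ultimately show ?case by (simp add: poly_linear_iff hasse_deriv_add)
qed

typedef (overloaded) ('n, 'k::field) diffop =
  "{f :: ('n, 'k) mpoly \<Rightarrow> ('n, 'k) mpoly. \<exists>m. diffop_below m f}"
  morphisms apply_diffop Diffop
  by (rule exI[of _ "\<lambda>_. 0"]) (auto intro: diffop_below_zero)

setup_lifting type_definition_diffop

instantiation diffop :: (type, field) ring_1
begin

lift_definition zero_diffop :: "('a, 'b) diffop" is "\<lambda>_. 0"
  by (auto intro: diffop_below_zero)

lift_definition one_diffop :: "('a, 'b) diffop" is "\<lambda>p. p"
  by (rule exI[of _ "Suc 0"]) (simp add: poly_linear_iff)

lift_definition plus_diffop :: "('a, 'b) diffop \<Rightarrow> ('a, 'b) diffop \<Rightarrow> ('a, 'b) diffop"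
  is "\<lambda>f g p. f p + g p"
  by (metis diffop_below_add diffop_below_mono max.cobounded1 max.cobounded2)

lift_definition uminus_diffop :: "('a, 'b) diffop \<Rightarrow> ('a, 'b) diffop" is "\<lambda>f p. - f p"
  using diffop_below_mult[of _ _ "-1"] by fastforce

lift_definition minus_diffop :: "('a, 'b) diffop \<Rightarrow> ('a, 'b) diffop \<Rightarrow> ('a, 'b) diffop"
  is "\<lambda>f g p. f p - g p"
proof -
  fix f g :: "('a, 'b) mpoly \<Rightarrow> ('a, 'b) mpoly"
  assume "\<exists>m. diffop_below m f" "\<exists>m. diffop_below m g"
  then obtain m l where "diffop_below m f" "diffop_below l g" by auto
  then have "diffop_below (max m l) (\<lambda>p. f p + (-1) * g p)"
    by (intro diffop_below_add diffop_below_mult) (auto elim: diffop_below_mono[rotated])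
  then show "\<exists>m. diffop_below m (\<lambda>p. f p - g p)" by auto
qed

lift_definition times_diffop :: "('a, 'b) diffop \<Rightarrow> ('a, 'b) diffop \<Rightarrow> ('a, 'b) diffop"
  is "\<lambda>f g p. f (g p)"
  using diffop_below_comp by blast

instance
proof
  fix a b c :: "('a, 'b) diffop"
  show "a * (b + c) = a * b + a * c"
    by transfer (auto simp: diffop_below_simps)
  show "(0 :: ('a, 'b) diffop) \<noteq> 1"
    by transfer (metis zero_neq_one)
qed (transfer; auto simp: algebra_simps)+

end

lift_definition diffop_scale :: "'k::field \<Rightarrow> ('n, 'k) diffop \<Rightarrow> ('n, 'k) diffop"
  is "\<lambda>c f p. poly_scale c (f p)"
  using diffop_below_mult unfolding poly_scale_def by blast

lift_definition dvar :: "'n \<Rightarrow> ('n, 'k::field) diffop" is "\<lambda>i p. poly_var i * p"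
  using diffop_below_poly by blast

lift_definition dpart :: "'n \<Rightarrow> nat \<Rightarrow> ('n, 'k::field) diffop" is hasse_deriv
  by (rule exI) (rule diffop_below_hasse_deriv)

lemma diffop_scale_vector_space:
  "vector_space (diffop_scale :: 'k::field \<Rightarrow> ('n, 'k) diffop \<Rightarrow> ('n, 'k) diffop)"
proof (rule vector_space.intro)
  interpret vector_space "poly_scale :: 'k \<Rightarrow> ('n, 'k) mpoly \<Rightarrow> ('n, 'k) mpoly"
    by (rule poly_scale_vector_space)
  fix a b :: 'k and x y :: "('n, 'k) diffop"
  show "diffop_scale a (x + y) = diffop_scale a x + diffop_scale a y"
    by transfer (simp add: scale_right_distrib)
  show "diffop_scale (a + b) x = diffop_scale a x + diffop_scale b x"
    by transfer (simp add: scale_left_distrib)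
  show "diffop_scale a (diffop_scale b x) = diffop_scale (a * b) x" by transfer simp
  show "diffop_scale 1 x = x" by transfer simp
qed

definition ad :: "'a::ring \<Rightarrow> 'a \<Rightarrow> 'a" where
  "ad r s = r * s - s * r"

text \<open>
  The \<open>x\<^sub>i\<close> and \<open>\<partial>\<^sub>i\<^bsup>[k]\<^esup>\<close> satisfy the relations of the presentation of \<open>\<D>(P\<^sub>n)\<close> by generators
  and relations.
\<close>

lemma dpart_0: "dpart i 0 = 1"
  by transfer auto

lemma ad_dvar_dvar: "ad (dvar i) (dvar j) = 0"
  unfolding ad_def by transfer (simp add: mult_ac)

lemma apply_of_nat: "apply_diffop (of_nat n) p = of_nat n * p"
  by (induction n) (simp_all add: zero_diffop.rep_eq one_diffop.rep_eq plus_diffop.rep_eq distrib_right)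

lemma dpart_mult: "dpart i k * dpart i l = of_nat (k + l choose k) * dpart i (k + l)"
proof -
  have "hasse_deriv i k (hasse_deriv i l p) = of_nat (k + l choose k) * hasse_deriv i (k + l) p"
    for p :: "('a, 'b) mpoly"
  proof (rule additive_eq_on_monomials[of _ _ p])
    fix m and c :: 'b
    show "hasse_deriv i k (hasse_deriv i l (Poly_Mapping.single m c)) =
        of_nat (k + l choose k) * hasse_deriv i (k + l) (Poly_Mapping.single m c)"
    proof (cases "k + l \<le> Poly_Mapping.lookup m i")
      case True
      have e: "m - Poly_Mapping.single i l - Poly_Mapping.single i k = m - Poly_Mapping.single i (k + l)"
        by (intro poly_mapping_eqI) (auto simp: lookup_minus lookup_single when_def)
      have "(Poly_Mapping.lookup m i choose l) * (Poly_Mapping.lookup m i - l choose k) =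
          (k + l choose k) * (Poly_Mapping.lookup m i choose (k + l))"
        using choose_mult[of l "k + l" "Poly_Mapping.lookup m i"] True
        by (simp add: binomial_symmetric[of k "k + l"] mult.commute)
      then have "(of_nat (Poly_Mapping.lookup m i - l choose k) * (of_nat (Poly_Mapping.lookup m i choose l) * c)) =
          of_nat (k + l choose k) * (of_nat (Poly_Mapping.lookup m i choose (k + l)) * c)"
        by (metis (no_types, lifting) mult.assoc mult.commute of_nat_mult)
      then show ?thesis
        by (simp only: hasse_deriv_single e lookup_minus lookup_single_eq mult_single
            single_of_nat[symmetric] add_0_left)
    next
      case False
      then have "Poly_Mapping.lookup m i < l \<or> Poly_Mapping.lookup m i - l < k" by auto
      then show ?thesis using False
        by (elim disjE) (simp_all add: hasse_deriv_single lookup_minus binomial_eq_0)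
    qed
  qed (simp_all add: hasse_deriv_add distrib_left)
  then show ?thesis
    by (simp add: apply_diffop_inject[symmetric] fun_eq_iff times_diffop.rep_eq dpart.rep_eq apply_of_nat)
qed

lemma ad_dpart_dpart: "ad (dpart i k) (dpart j l) = 0"
proof (cases "i = j")
  case True
  moreover have "dpart i k * dpart i l = dpart i l * dpart i k"
    using binomial_symmetric[of k "k + l"] by (simp only: dpart_mult) (simp add: add.commute)
  ultimately show ?thesis by (simp only: ad_def) simp
next
  case False
  have "hasse_deriv i k (hasse_deriv j l p) = hasse_deriv j l (hasse_deriv i k p)"
    for p :: "('a, 'b) mpoly"
  proof (rule additive_eq_on_monomials[of _ _ p])
    fix m and c :: 'b
    have "m - Poly_Mapping.single j l - Poly_Mapping.single i k =
        m - Poly_Mapping.single i k - Poly_Mapping.single j l"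
      by (intro poly_mapping_eqI) (auto simp: lookup_minus)
    then show "hasse_deriv i k (hasse_deriv j l (Poly_Mapping.single m c)) =
        hasse_deriv j l (hasse_deriv i k (Poly_Mapping.single m c))"
      using False by (simp add: hasse_deriv_single lookup_minus lookup_single mult_ac)
  qed (simp_all add: hasse_deriv_add)
  then show ?thesis
    unfolding ad_def by transfer simp
qed

lemma ad_dpart_dvar:
  assumes "k \<ge> 1"
  shows "ad (dpart i k) (dvar j) = (if i = j then dpart i (k - 1) else 0)"
proof -
  let ?x = "poly_var j :: ('a, 'b) mpoly"
  have var1: "hasse_deriv i 1 ?x = (if i = j then 1 else 0)"
    by (simp add: poly_var_def hasse_deriv_single lookup_single)
  have var2: "hasse_deriv i a ?x = 0" if "a \<notin> {0, 1}" for a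
  proof -
    have "(Poly_Mapping.lookup (Poly_Mapping.single j (1 :: nat)) i choose a) = 0"
      using that by (intro binomial_eq_0) (auto simp: lookup_single when_def)
    then show ?thesis by (simp only: poly_var_def hasse_deriv_single) simp
  qed
  have "hasse_deriv i k (?x * q) - ?x * hasse_deriv i k q =
      (if i = j then hasse_deriv i (k - 1) q else 0)" for q
  proof -
    have "hasse_deriv i k (?x * q) = (\<Sum>a\<in>{0, 1}. hasse_deriv i a ?x * hasse_deriv i (k - a) q)"
      unfolding hasse_deriv_leibniz
      by (rule sum.mono_neutral_right) (use assms var2 in auto)
    also have "\<dots> = ?x * hasse_deriv i k q + (if i = j then hasse_deriv i (k - 1) q else 0)"
      using var1 by simp
    finally show ?thesis by simp
  qed
  then show ?thesis
    by (simp add: ad_def apply_diffop_inject[symmetric] fun_eq_iff minus_diffop.rep_eq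
        times_diffop.rep_eq dvar.rep_eq dpart.rep_eq zero_diffop.rep_eq)
qed

section \<open>The maps attached to an automorphism\<close>

definition diffop_automorphism ::
  "(('n, 'k::field) diffop \<Rightarrow> ('n, 'k) diffop) \<Rightarrow> bool" where
  "diffop_automorphism \<sigma> \<longleftrightarrow> Vector_Spaces.linear diffop_scale diffop_scale \<sigma> \<and>
     (\<forall>a b. \<sigma> (a * b) = \<sigma> a * \<sigma> b) \<and> \<sigma> 1 = 1 \<and> bij \<sigma>"

abbreviation indices :: "'n::{finite, linorder} list" where
  "indices \<equiv> sorted_list_of_set UNIV"

definition monom_dvar :: "('n::{finite, linorder} \<Rightarrow> nat) \<Rightarrow> ('n, 'k::field) diffop" where
  "monom_dvar \<alpha> = prod_list (map (\<lambda>i. dvar i ^ \<alpha> i) indices)"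

definition monom_dpart :: "('n::{finite, linorder} \<Rightarrow> nat) \<Rightarrow> ('n, 'k::field) diffop" where
  "monom_dpart \<beta> = prod_list (map (\<lambda>i. dpart i (\<beta> i)) indices)"

context
  fixes \<sigma> :: "('n::{finite, linorder}, 'k::field) diffop \<Rightarrow> ('n, 'k) diffop"
begin

definition dvar' :: "'n \<Rightarrow> ('n, 'k) diffop" where
  "dvar' i = \<sigma> (dvar i)"

definition dpart' :: "'n \<Rightarrow> nat \<Rightarrow> ('n, 'k) diffop" where
  "dpart' i k = \<sigma> (dpart i k)"

definition monom_dpart' :: "('n \<Rightarrow> nat) \<Rightarrow> ('n, 'k) diffop" where
  "monom_dpart' \<alpha> = prod_list (map (\<lambda>i. dpart' i (\<alpha> i)) indices)"

definition delta' :: "('n \<Rightarrow> nat) \<Rightarrow> ('n, 'k) diffop \<Rightarrow> ('n, 'k) diffop" where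
  "delta' \<beta> = foldr (\<lambda>i. (\<lambda>a. - ad (dvar' i) a) ^^ \<beta> i) indices"

text \<open>
  For an automorphism \<open>\<sigma>\<close> the two sums below have finite support, since \<open>ad x\<^sub>i'\<close> is locally
  nilpotent (see \<open>finite_phi_support\<close>, \<open>finite_psi_support\<close>).
\<close>

definition phi' :: "'n \<Rightarrow> ('n, 'k) diffop \<Rightarrow> ('n, 'k) diffop" where
  "phi' i a = Sum_any (\<lambda>k. dpart' i k * (ad (dvar' i) ^^ k) a)"

definition psi' :: "'n \<Rightarrow> ('n, 'k) diffop \<Rightarrow> ('n, 'k) diffop" where
  "psi' i a = Sum_any (\<lambda>k. (ad (dvar' i) ^^ k) a * dpart' i k)"

text \<open>
  The maps \<open>\<phi>\<^bsub>n+i,k\<^esub>'\<close> and \<open>\<phi>\<^bsub>n+i\<^esub>'\<close>. Both are given by formulas that make sense on all of \<open>\<D>\<close>,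
  but are only ever applied on the image \<open>P\<^sub>n'\<close> of \<open>\<phi>\<^sub>n' \<cdots> \<phi>\<^sub>1'\<close> or \<open>\<psi>\<^sub>1' \<cdots> \<psi>\<^sub>n'\<close>. The infinite
  product \<open>\<cdots> \<phi>\<^bsub>n+i,1\<^esub>' \<phi>\<^bsub>n+i,0\<^esub>'\<close> is the eventually constant value of its partial products.
\<close>

definition phi_const_step' :: "'n \<Rightarrow> nat \<Rightarrow> ('n, 'k) diffop \<Rightarrow> ('n, 'k) diffop" where
  "phi_const_step' i k a = (\<Sum>j < CHAR('k).
     diffop_scale ((- 1) ^ j / of_nat (fact j))
       (dvar' i ^ (CHAR('k) ^ k * j) * (ad (dpart' i (CHAR('k) ^ k)) ^^ j) a))"

definition phi_const' :: "'n \<Rightarrow> ('n, 'k) diffop \<Rightarrow> ('n, 'k) diffop" where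
  "phi_const' i a =
     (THE b. eventually (\<lambda>N. fold (phi_const_step' i) [0..<N] a = b) sequentially)"

definition phi_full :: "('n, 'k) diffop \<Rightarrow> ('n, 'k) diffop" where
  "phi_full a = fold phi_const' indices (fold phi' indices a)"

definition psi_full :: "('n, 'k) diffop \<Rightarrow> ('n, 'k) diffop" where
  "psi_full a = fold phi_const' indices (foldr psi' indices a)"

end

lemma ad_dvar_nilpotent: "\<exists>m. \<forall>k\<ge>m. (ad (dvar i) ^^ k) a = 0"
proof -
  have "diffop_below m (apply_diffop a) \<Longrightarrow> (ad (dvar i) ^^ m) a = 0" for m
  proof (induction m arbitrary: a)
    case 0
    then show ?case by (simp add: apply_diffop_inject[symmetric] zero_diffop.rep_eq)
  next
    case (Suc m)
    have "apply_diffop (ad (dvar i) a) = (\<lambda>q. (- 1) * (apply_diffop a (poly_var i * q) - poly_var i * apply_diffop a q))"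
      by (simp add: ad_def fun_eq_iff minus_diffop.rep_eq times_diffop.rep_eq dvar.rep_eq)
    then have "diffop_below m (apply_diffop (ad (dvar i) a))"
      using Suc.prems by (simp only: diffop_below.simps(2) diffop_below_mult)
    then show ?case using Suc.IH by (simp add: funpow_swap1)
  qed
  moreover obtain m where "diffop_below m (apply_diffop a)"
    using apply_diffop[of a] by blast
  ultimately show ?thesis using diffop_below_mono by blast
qed

lemma ad_dvar'_nilpotent:
  assumes "diffop_automorphism \<sigma>"
  shows "\<exists>m. \<forall>k\<ge>m. (ad (dvar' \<sigma> i) ^^ k) a = 0"
proof -
  have lin: "Vector_Spaces.linear diffop_scale diffop_scale \<sigma>"
    and mult: "\<sigma> (r * s) = \<sigma> r * \<sigma> s" and "bij \<sigma>" for r s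
    using assms by (auto simp: diffop_automorphism_def)
  interpret Vector_Spaces.linear diffop_scale diffop_scale \<sigma> by (fact lin)
  obtain b where b: "a = \<sigma> b" using \<open>bij \<sigma>\<close> by (metis bij_pointE)
  have "(ad (dvar' \<sigma> i) ^^ k) (\<sigma> b) = \<sigma> ((ad (dvar i) ^^ k) b)" for k
    by (induction k) (simp_all add: ad_def dvar'_def mult diff)
  then show ?thesis using ad_dvar_nilpotent[of i b] zero unfolding b by metis
qed

lemma finite_phi_support:
  assumes "diffop_automorphism \<sigma>"
  shows "finite {k. dpart' \<sigma> i k * (ad (dvar' \<sigma> i) ^^ k) a \<noteq> 0}"
proof -
  obtain m where "\<forall>k\<ge>m. (ad (dvar' \<sigma> i) ^^ k) a = 0"
    using ad_dvar'_nilpotent[OF assms] by blast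
  then show ?thesis by (intro finite_subset[OF _ finite_lessThan[of m]]) (force simp flip: not_le)
qed

lemma finite_psi_support:
  assumes "diffop_automorphism \<sigma>"
  shows "finite {k. (ad (dvar' \<sigma> i) ^^ k) a * dpart' \<sigma> i k \<noteq> 0}"
proof -
  obtain m where "\<forall>k\<ge>m. (ad (dvar' \<sigma> i) ^^ k) a = 0"
    using ad_dvar'_nilpotent[OF assms] by blast
  then show ?thesis by (intro finite_subset[OF _ finite_lessThan[of m]]) (force simp flip: not_le)
qed

text \<open>
  \<open>s\<close> is the sum of the family \<open>f\<close>, all but finitely many of whose terms vanish. The finiteness
  is stated separately because \<open>Sum_any f = 0\<close> for every family with infinite support.
\<close>

definition has_finite_sum :: "('i \<Rightarrow> 'a::comm_monoid_add) \<Rightarrow> 'a \<Rightarrow> bool" where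
  "has_finite_sum f s \<longleftrightarrow> finite {i. f i \<noteq> 0} \<and> Sum_any f = s"

end

theory Submission
  imports Defs "HOL-Library.FuncSet" "HOL-Computational_Algebra.Primes"
begin

text \<open>
  The theorem is the reading off of coefficients in a basis. Let first \<open>\<sigma> = id\<close>, and put
  \<open>\<delta>\<^sub>i = [\<cdot>, x\<^sub>i]\<close>, which is \<open>del i\<close> below. Since \<open>\<delta>\<^sub>i\<close> is locally nilpotent and lowers \<open>\<partial>\<^sub>i\<^bsup>[k]\<^esup>\<close> to
  \<open>\<partial>\<^sub>i\<^bsup>[k-1]\<^esup>\<close>, there is a Taylor expansion along it, with \<open>\<psi>\<^sub>i\<close> or \<open>\<phi>\<^sub>i\<close> as the evaluation at zero:
  every \<open>b\<close> is \<open>\<Sum>\<^sub>k \<psi>\<^sub>i(\<delta>\<^sub>i\<^sup>k b) \<partial>\<^sub>i\<^bsup>[k]\<^esup>\<close> and also \<open>\<Sum>\<^sub>k \<partial>\<^sub>i\<^bsup>[k]\<^esup> \<phi>\<^sub>i(\<delta>\<^sub>i\<^sup>k b)\<close>. Doing this for all variables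
  (\<open>multi_taylor\<close>) gives coefficients that commute with all \<open>x\<^sub>i\<close>, and these are polynomials, as \<open>P\<^sub>n\<close>
  is its own centralizer (\<open>eq_mulop_of_del_eq_0\<close>). Write \<open>\<psi>\<close> and \<open>\<phi>\<close> for the products of the \<open>\<psi>\<^sub>i\<close>
  and of the \<open>\<phi>\<^sub>i\<close>.

  It remains to find the coefficient at \<open>x\<^sup>\<alpha>\<close> of the polynomials \<open>\<psi>(\<delta>\<^sup>\<beta> b)\<close> and \<open>\<phi>(\<delta>\<^sup>\<beta> b)\<close>. In a
  polynomial it is the constant term after an application of \<open>\<partial>\<^bsup>[\<alpha>]\<^esup>\<close>, and this application can be
  done before the projection:
  \<^item> \<open>\<psi>(c)\<close> is the value \<open>c(1)\<close> (\<open>psi_all\<close>), so \<open>\<psi>(\<partial>\<^bsup>[\<alpha>]\<^esup> c) = \<partial>\<^bsup>[\<alpha>]\<^esup>(\<psi>(c))\<close>;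
  \<^item> \<open>\<phi>\<close> is the projection along the right ideal generated by the \<open>\<partial>\<^sub>i\<^bsup>[k]\<^esup>\<close> with \<open>k > 0\<close>, and it satisfies
    \<open>\<phi>(c \<partial>\<^bsup>[\<alpha>]\<^esup>) = (-1)\<^bsup>|\<alpha>|\<^esup> \<partial>\<^bsup>[\<alpha>]\<^esup>(\<phi>(c))\<close> (\<open>phi_poly_dpart\<close>), whence the sign in the first formula.

  The maps \<open>\<phi>\<^bsub>n+i\<^esub>\<close> extract the constant term: \<open>\<phi>\<^bsub>n+i,k\<^esub>\<close> keeps those monomials whose exponent of \<open>x\<^sub>i\<close>,
  already a multiple of \<open>p\<^sup>k\<close>, is a multiple of \<open>p\<^bsup>k+1\<^esup>\<close> (\<open>phi_const_step_single\<close>, by binomial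
  coefficients modulo \<open>p\<close>), and an exponent divisible by all powers of \<open>p\<close> is zero.

  For general \<open>\<sigma>\<close> write \<open>a = \<sigma>(b)\<close>. All primed maps are conjugates under \<open>\<sigma>\<close> of those for \<open>id\<close>, and
  \<open>\<phi>\<^sub>\<sigma>\<close> and \<open>\<psi>\<^sub>\<sigma>\<close> take scalar values, which \<open>\<sigma>\<close> fixes. So the coefficients computed from \<open>a\<close> are
  those of \<open>b\<close>.
\<close>

section \<open>Taylor expansion along a locally nilpotent map\<close>

text \<open>
  The model is \<open>E = d/dt\<close> and \<open>T k = t\<^sup>k / k!\<close> acting on polynomials in \<open>t\<close>: then \<open>proj\<close> below is
  evaluation at \<open>t = 0\<close>, namely \<open>\<Sum>\<^sub>k (-t)\<^sup>k / k! E\<^sup>k\<close>, and \<open>taylor\<close> is the usual expansion at \<open>0\<close>.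
  The instances wanted are \<open>E = [\<cdot>, x\<^sub>i]\<close> on \<open>\<D>\<close>, with \<open>T k\<close> the left or the right multiplication
  by \<open>\<partial>\<^sub>i\<^bsup>[k]\<^esup>\<close>. Divided powers are used because \<open>k!\<close> need not be invertible.
\<close>

locale taylor_pair =
  fixes E :: "'a::ring_1 \<Rightarrow> 'a" and T :: "nat \<Rightarrow> 'a \<Rightarrow> 'a"
  assumes E_add: "E (x + y) = E x + E y"
    and T_add: "T k (x + y) = T k x + T k y"
    and T_0: "T 0 x = x"
    and T_T: "T k (T l x) = of_nat (k + l choose k) * T (k + l) x"
    and E_T: "E (T (Suc k) x) = T k x + T (Suc k) (E x)"
    and nilpotent: "\<exists>M. (E ^^ M) x = 0"
begin

definition proj :: "'a \<Rightarrow> 'a" where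
  "proj x = Sum_any (\<lambda>k. (- 1) ^ k * T k ((E ^^ k) x))"

lemma E_zero: "E 0 = 0" and T_zero: "T k 0 = 0"
  using E_add[of 0 0] T_add[of k 0 0] by simp_all

lemma E_minus: "E (- x) = - E x" and T_minus: "T k (- x) = - T k x"
  using E_add[of x "- x"] T_add[of k x "- x"] by (simp_all add: E_zero T_zero minus_unique)

lemma E_sum: "E (sum f A) = (\<Sum>a\<in>A. E (f a))" and T_sum: "T k (sum f A) = (\<Sum>a\<in>A. T k (f a))"
  by (induction A rule: infinite_finite_induct; simp add: E_zero T_zero E_add T_add)+

lemma E_sign: "E ((- 1) ^ j * x) = (- 1) ^ j * E x"
  and T_sign: "T k ((- 1) ^ j * x) = (- 1) ^ j * T k x"
  by (cases "even j"; simp add: E_minus T_minus)+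

lemma E_funpow_zero: "(E ^^ k) 0 = 0"
  by (induction k) (simp_all add: E_zero)

lemma E_funpow_add: "(E ^^ k) (x + y) = (E ^^ k) x + (E ^^ k) y"
  by (induction k) (simp_all add: E_add)

lemma E_funpow_eq_0_mono: "(E ^^ M) x = 0 \<Longrightarrow> M \<le> k \<Longrightarrow> (E ^^ k) x = 0"
  by (metis E_funpow_zero funpow_add le_add_diff_inverse2 o_apply)

lemma proj_eq:
  assumes "(E ^^ M) x = 0"
  shows "proj x = (\<Sum>k<M. (- 1) ^ k * T k ((E ^^ k) x))"
  unfolding proj_def
proof (rule Sum_any.expand_superset)
  show "{k. (- 1) ^ k * T k ((E ^^ k) x) \<noteq> 0} \<subseteq> {..<M}"
    using E_funpow_eq_0_mono[OF assms] T_zero by (force simp: not_le[symmetric])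
qed simp

lemma proj_zero: "proj 0 = 0"
  using proj_eq[of 0 0] by simp

lemma proj_add: "proj (x + y) = proj x + proj y"
proof -
  obtain M N where "(E ^^ M) x = 0" "(E ^^ N) y = 0" using nilpotent by metis
  then have "(E ^^ max M N) x = 0" "(E ^^ max M N) y = 0"
    using E_funpow_eq_0_mono max.cobounded1 max.cobounded2 by metis+
  then show ?thesis
    by (simp add: proj_eq[of "max M N"] E_funpow_add T_add distrib_left sum.distrib)
qed

lemma proj_sum: "proj (sum f A) = (\<Sum>a\<in>A. proj (f a))"
  by (induction A rule: infinite_finite_induct) (simp_all add: proj_zero proj_add)

text \<open>
  Applying \<open>E\<close> to the \<open>k\<close>-th term of \<open>proj x\<close> gives, up to sign, \<open>T (k-1) E\<^sup>k x + T k E\<^bsup>k+1\<^esup> x\<close>;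
  the signs alternate, so the sum telescopes.
\<close>

lemma E_proj: "E (proj x) = 0"
proof -
  obtain M where M: "(E ^^ M) x = 0" using nilpotent by blast
  \<comment> \<open>\<open>g k\<close> is, up to sign, the part of the \<open>k\<close>-th term in which \<open>E\<close> has lowered \<open>T k\<close>.\<close>
  define g where "g k = (case k of 0 \<Rightarrow> 0 | Suc j \<Rightarrow> (- 1) ^ j * T j ((E ^^ Suc j) x))" for k
  have "E ((- 1) ^ k * T k ((E ^^ k) x)) = g (Suc k) - g k" for k
    by (cases k) (simp_all add: E_sign E_minus g_def T_0 E_T algebra_simps)
  moreover have "(\<Sum>k<M. g (Suc k) - g k) = g M - g 0" by (rule sum_lessThan_telescope)
  moreover have "g M = 0" using M by (cases M) (simp_all add: g_def T_zero)
  ultimately show ?thesis by (simp add: proj_eq[OF M] E_sum) (simp add: g_def)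
qed

text \<open>
  Collecting the double sum on the right by the total index \<open>m\<close>, the coefficient of \<open>T m (E\<^sup>m x)\<close>
  is \<open>\<Sum>\<^sub>k (-1)\<^bsup>m-k\<^esup> (m choose k)\<close>, which vanishes unless \<open>m = 0\<close>.
\<close>

lemma taylor:
  assumes "(E ^^ M) x = 0"
  shows "x = (\<Sum>k<M. T k (proj ((E ^^ k) x)))"
proof -
  have vanish: "(E ^^ k) x = 0" if "M \<le> k" for k
    using E_funpow_eq_0_mono[OF assms that] .
  have expand: "T k (proj ((E ^^ k) x)) =
      (\<Sum>j<M. (- 1) ^ j * (of_nat (k + j choose k) * T (k + j) ((E ^^ (k + j)) x)))" for k
  proof -
    have "(E ^^ M) ((E ^^ k) x) = 0"
      using vanish[of "M + k"] by (simp add: funpow_add)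
    then have "proj ((E ^^ k) x) = (\<Sum>j<M. (- 1) ^ j * T j ((E ^^ j) ((E ^^ k) x)))"
      by (rule proj_eq)
    moreover have "(E ^^ j) ((E ^^ k) x) = (E ^^ (k + j)) x" for j
      by (simp add: funpow_add[symmetric] add.commute flip: o_apply[of "E ^^ j"])
    ultimately show ?thesis by (simp add: T_sum T_sign T_T)
  qed
  define h where "h k j = (- 1) ^ j * (of_nat (k + j choose k) * T (k + j) ((E ^^ (k + j)) x))" for k j
  have "(\<Sum>k<M. T k (proj ((E ^^ k) x))) = (\<Sum>(k, j)\<in>{..<M} \<times> {..<M}. h k j)"
    by (simp add: expand h_def sum.cartesian_product)
  also have "\<dots> = (\<Sum>(k, j)\<in>{(k, j). k + j < M}. h k j)"
  proof (rule sum.mono_neutral_right)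
    have "h k j = 0" if "\<not> k + j < M" for k j
      using vanish[of "k + j"] that by (simp add: h_def T_zero)
    then show "\<forall>x \<in> {..<M} \<times> {..<M} - {(k, j). k + j < M}. (case x of (k, j) \<Rightarrow> h k j) = 0" by auto
  qed auto
  also have "\<dots> = (\<Sum>m<M. \<Sum>k\<le>m. h k (m - k))"
    by (rule sum.triangle_reindex)
  also have "\<dots> = (\<Sum>m<M. if m = 0 then x else 0)"
  proof (rule sum.cong[OF refl])
    fix m
    have "(\<Sum>k\<le>m. h k (m - k)) = (\<Sum>k\<le>m. (- 1) ^ (m - k) * of_nat (m choose k)) * T m ((E ^^ m) x)"
      unfolding sum_distrib_right by (rule sum.cong) (simp_all add: h_def mult.assoc)
    also have "(\<Sum>k\<le>m. (- 1) ^ (m - k) * of_nat (m choose k) :: 'a) =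
        (\<Sum>k\<le>m. (- 1) ^ k * of_nat (m choose k))"
      by (rule sum.reindex_bij_witness[of _ "\<lambda>k. m - k" "\<lambda>k. m - k"])
        (auto simp: binomial_symmetric[symmetric])
    also have "\<dots> = of_int (\<Sum>k\<le>m. (- 1) ^ k * of_nat (m choose k))"
      by simp
    also have "(\<Sum>k\<le>m. (- 1) ^ k * of_nat (m choose k) :: int) = (if m = 0 then 1 else 0)"
      using choose_alternating_sum[of m, where ?'a = int] by simp
    finally show "(\<Sum>k\<le>m. h k (m - k)) = (if m = 0 then x else 0)"
      by (simp add: T_0)
  qed
  also have "\<dots> = x"
    using assms by (cases M) (simp_all del: sum.lessThan_Suc)
  finally show ?thesis ..
qed

lemma E_funpow_T:
  assumes "E r = 0"
  shows "(E ^^ j) (T k r) = (if j \<le> k then T (k - j) r else 0)"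
proof (induction j)
  case (Suc j)
  show ?case
  proof (cases "j < k")
    case True
    then have "k - j = Suc (k - Suc j)" by simp
    then show ?thesis using Suc True by (simp add: E_T assms T_zero)
  next
    case False
    then show ?thesis using Suc by (auto simp: T_0 assms E_zero)
  qed
qed simp

text \<open>
  If \<open>E r = 0\<close>, then \<open>proj (T k r)\<close> is \<open>T k r\<close> times an alternating sum of binomial coefficients.
  The Taylor expansion writes every \<open>x\<close> by means of such \<open>r\<close>, and \<open>T k T l\<close> is a multiple of
  \<open>T (k + l)\<close>.
\<close>

lemma proj_T:
  assumes "k > 0"
  shows "proj (T k x) = 0"
proof -
  have *: "proj (T k r) = 0" if "E r = 0" "k > 0" for k r
  proof -
    have "(E ^^ Suc k) (T k r) = 0" by (simp only: E_funpow_T[OF that(1)]) simp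
    then have "proj (T k r) = (\<Sum>j<Suc k. (- 1) ^ j * T j ((E ^^ j) (T k r)))"
      by (rule proj_eq)
    also have "\<dots> = (\<Sum>j\<le>k. (- 1) ^ j * of_nat (k choose j)) * T k r"
      unfolding sum_distrib_right lessThan_Suc_atMost
      by (rule sum.cong) (auto simp: E_funpow_T[OF that(1)] T_T mult.assoc)
    also have "(\<Sum>j\<le>k. (- 1) ^ j * of_nat (k choose j) :: 'a) =
        of_int (\<Sum>j\<le>k. (- 1) ^ j * of_nat (k choose j))"
      by simp
    also have "\<dots> = 0"
      using choose_alternating_sum[of k, where ?'a = int] that(2) by simp
    finally show ?thesis by simp
  qed
  have of_nat: "proj (of_nat n * y) = of_nat n * proj y" for n y
    by (induction n) (simp_all add: proj_zero proj_add distrib_right)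
  obtain M where "(E ^^ M) x = 0" using nilpotent by blast
  from taylor[OF this] have "proj (T k x) = proj (T k (\<Sum>l<M. T l (proj ((E ^^ l) x))))"
    by simp
  also have "\<dots> = 0"
    by (simp add: T_sum proj_sum T_T of_nat * E_proj assms)
  finally show ?thesis .
qed

lemma proj_commute:
  assumes add: "\<And>x y. F (x + y) = F x + F y"
    and E: "\<And>x. F (E x) = E (F x)" and T: "\<And>k x. F (T k x) = T k (F x)"
  shows "F (proj x) = proj (F x)"
proof -
  obtain M where M: "(E ^^ M) x = 0" using nilpotent by blast
  have zero: "F 0 = 0" using add[of 0 0] by simp
  have minus: "F (- y) = - F y" for y
    using add[of y "- y"] by (simp add: zero minus_unique)
  have sign: "F ((- 1) ^ j * y) = (- 1) ^ j * F y" for j y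
    by (cases "even j") (simp_all add: minus)
  have sum: "F (sum f A) = (\<Sum>a\<in>A. F (f a))" for f and A :: "nat set"
    by (induction A rule: infinite_finite_induct) (simp_all add: zero add)
  have pow: "F ((E ^^ k) x) = (E ^^ k) (F x)" for k
    by (induction k) (simp_all add: E)
  then have M': "(E ^^ M) (F x) = 0" by (metis M zero)
  show ?thesis by (simp add: proj_eq[OF M] proj_eq[OF M'] sum sign T pow)
qed

end

text \<open>
  Several Taylor pairs, one for each variable, that do not interact. All projections and lowering
  maps then commute, and the order in which they are composed becomes irrelevant.
\<close>

locale taylor_family =
  fixes E :: "'i \<Rightarrow> 'a::ring_1 \<Rightarrow> 'a" and T :: "'i \<Rightarrow> nat \<Rightarrow> 'a \<Rightarrow> 'a"
  assumes pair: "taylor_pair (E i) (T i)"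
    and E_E: "E i (E j x) = E j (E i x)"
    and E_T_neq: "i \<noteq> j \<Longrightarrow> E i (T j k x) = T j k (E i x)"
    and T_T_neq: "i \<noteq> j \<Longrightarrow> T i l (T j k x) = T j k (T i l x)"
begin

sublocale taylor_pair "E i" "T i" for i
  by (rule pair)

lemma E_proj_neq: "i \<noteq> j \<Longrightarrow> E i (proj j x) = proj j (E i x)"
  by (rule proj_commute) (simp_all add: E_add E_E E_T_neq)

lemma T_proj_neq: "i \<noteq> j \<Longrightarrow> T i k (proj j x) = proj j (T i k x)"
  by (rule proj_commute) (simp_all add: T_add E_T_neq T_T_neq)

lemma proj_proj: "proj i (proj j x) = proj j (proj i x)"
proof (cases "i = j")
  case False
  then show ?thesis
    by (intro proj_commute) (simp_all add: proj_add E_proj_neq T_proj_neq)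
qed simp

lemma E_projs:
  "i \<in> set is \<Longrightarrow> E i (foldr proj is x) = 0"
  "i \<notin> set is \<Longrightarrow> E i (foldr proj is x) = foldr proj is (E i x)"
proof (induction "is")
  case (Cons j js)
  {
    case 1
    then show ?case using Cons by (cases "i = j") (auto simp: E_proj E_proj_neq proj_zero)
  next
    case 2
    then show ?case using Cons by (auto simp: E_proj_neq)
  }
qed auto

text \<open>
  The one-variable expansions for the variables in \<open>is\<close>, nested: each coefficient
  \<open>proj i ((E i)\<^sup>k x)\<close> of the first is expanded along the remaining variables, and commutation brings
  all projections to the left of all \<open>E\<close>. The exponent families live in the box \<open>Pi\<^sub>E\<close> so that
  they are determined by their values on the variables in \<open>is\<close>.
\<close>

lemma multi_taylor:
  assumes "distinct is" "\<And>i. i \<in> set is \<Longrightarrow> (E i ^^ M) x = 0"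
  shows "x = (\<Sum>\<beta>\<in>Pi\<^sub>E (set is) (\<lambda>_. {..<M}).
    foldr (\<lambda>i. T i (\<beta> i)) is (foldr proj is (foldr (\<lambda>i. E i ^^ \<beta> i) is x)))"
  using assms
proof (induction "is" arbitrary: x)
  case (Cons i js)
  let ?B = "Pi\<^sub>E (set js) (\<lambda>_. {..<M})"
  let ?t = "\<lambda>js \<beta> x. foldr (\<lambda>i. T i (\<beta> i)) js (foldr proj js (foldr (\<lambda>i. E i ^^ \<beta> i) js x))"
  have i: "i \<notin> set js" using Cons.prems by simp
  define w where "w k = proj i ((E i ^^ k) x)" for k
  have E_pows_pow: "(E j ^^ l) ((E i ^^ k) y) = (E i ^^ k) ((E j ^^ l) y)" for j k l y
  proof -
    have 1: "E j ((E i ^^ k) y) = (E i ^^ k) (E j y)" for y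
      by (induction k) (simp_all add: E_E)
    show ?thesis by (induction l) (simp_all add: 1)
  qed
  have E_pows_proj: "(E j ^^ l) (proj i y) = proj i ((E j ^^ l) y)" if "j \<noteq> i" for j l y
    by (induction l) (simp_all add: E_proj_neq that)
  have move: "?t js \<beta> (w k) =
      foldr (\<lambda>i. T i (\<beta> i)) js (proj i (foldr proj js ((E i ^^ k) (foldr (\<lambda>i. E i ^^ \<beta> i) js x))))" for \<beta> k
  proof -
    have "foldr (\<lambda>i. E i ^^ \<beta> i) js (w k) = proj i (foldr (\<lambda>i. E i ^^ \<beta> i) js ((E i ^^ k) x))"
      unfolding w_def using i by (induction js) (auto simp: E_pows_proj)
    moreover have "foldr (\<lambda>i. E i ^^ \<beta> i) js ((E i ^^ k) x) = (E i ^^ k) (foldr (\<lambda>i. E i ^^ \<beta> i) js x)"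
      by (induction js) (auto simp: E_pows_pow)
    moreover have "foldr proj js (proj i y) = proj i (foldr proj js y)" for y
      by (induction js) (auto simp: proj_proj)
    ultimately show ?thesis by simp
  qed
  have swap: "foldr proj js ((E i ^^ k) y) = (E i ^^ k) (foldr proj js y)" for k y
    by (induction k) (simp_all add: E_projs(2)[OF i, symmetric])
  have step: "T i k (?t js \<beta> (w k)) = ?t (i # js) (\<beta>(i := k)) x" for \<beta> k
  proof -
    have cong: "foldr (\<lambda>j. f j ((\<beta>(i := k)) j)) js z = foldr (\<lambda>j. f j (\<beta> j)) js z"
      for f :: "'i \<Rightarrow> nat \<Rightarrow> 'a \<Rightarrow> 'a" and z
      by (rule foldr_cong) (use i in auto)
    have "foldr proj (i # js) (foldr (\<lambda>j. E j ^^ (\<beta>(i := k)) j) (i # js) x) =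
        proj i (foldr proj js ((E i ^^ k) (foldr (\<lambda>j. E j ^^ \<beta> j) js x)))"
      using cong[of "\<lambda>j n. E j ^^ n"] by simp
    then show ?thesis
      using cong[of T] by (simp add: move)
  qed
  have wM: "(E j ^^ M) (w k) = 0" if "j \<in> set js" for j k
  proof -
    have "j \<noteq> i" "(E j ^^ M) x = 0" using that i Cons.prems by auto
    then show ?thesis
      by (simp add: w_def E_pows_proj E_pows_pow E_funpow_zero proj_zero)
  qed
  have "x = (\<Sum>k<M. T i k (w k))"
    unfolding w_def by (rule taylor) (simp add: Cons.prems)
  also have "\<dots> = (\<Sum>k<M. T i k (\<Sum>\<beta>\<in>?B. ?t js \<beta> (w k)))"
  proof (rule sum.cong[OF refl])
    fix k
    have "w k = (\<Sum>\<beta>\<in>?B. ?t js \<beta> (w k))"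
      by (rule Cons.IH) (use Cons.prems wM in auto)
    then show "T i k (w k) = T i k (\<Sum>\<beta>\<in>?B. ?t js \<beta> (w k))" by simp
  qed
  also have "\<dots> = (\<Sum>(k, \<beta>)\<in>{..<M} \<times> ?B. ?t (i # js) (\<beta>(i := k)) x)"
    by (simp add: T_sum step sum.cartesian_product del: foldr.simps)
  also have "\<dots> = (\<Sum>\<beta>\<in>(\<lambda>(k, \<beta>). \<beta>(i := k)) ` ({..<M} \<times> ?B). ?t (i # js) \<beta> x)"
    by (subst sum.reindex[OF inj_combinator[OF i]]) (simp add: case_prod_beta o_def del: foldr.simps)
  finally show ?case by (simp add: PiE_insert_eq)
qed simp

end

section \<open>Differential operators commuting with the variables\<close>

lemma diffop_eqI: "(\<And>p. apply_diffop a p = apply_diffop b p) \<Longrightarrow> a = b"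
  by (simp add: apply_diffop_inject[symmetric] fun_eq_iff)

lemmas apply_simps = zero_diffop.rep_eq one_diffop.rep_eq plus_diffop.rep_eq
  minus_diffop.rep_eq uminus_diffop.rep_eq times_diffop.rep_eq dvar.rep_eq dpart.rep_eq

lemma
  shows apply_add: "apply_diffop a (p + q) = apply_diffop a p + apply_diffop a q"
    and apply_scale: "apply_diffop a (poly_scale c p) = poly_scale c (apply_diffop a p)"
    and apply_zero: "apply_diffop a 0 = 0"
  using apply_diffop[of a] diffop_below_simps by blast+

lemma apply_sum_left: "apply_diffop (sum f A) p = (\<Sum>x\<in>A. apply_diffop (f x) p)"
  by (induction A rule: infinite_finite_induct) (simp_all add: apply_simps)

lemma apply_sign: "apply_diffop ((- 1) ^ k) p = (- 1) ^ k * p"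
  by (cases "even k") (simp_all add: apply_simps)

definition mulop :: "('n, 'k::field) mpoly \<Rightarrow> ('n, 'k) diffop" where
  "mulop p = Diffop ((*) p)"

lemma apply_mulop: "apply_diffop (mulop p) q = p * q"
  unfolding mulop_def by (subst Diffop_inverse) (use diffop_below_poly[of p] in blast)+

lemma mulop_add: "mulop (p + q) = mulop p + mulop q"
  and mulop_mult: "mulop (p * q) = mulop p * mulop q"
  and mulop_0: "mulop 0 = 0"
  and mulop_1: "mulop 1 = 1"
  and mulop_minus: "mulop (- p) = - mulop p"
  and dvar_eq_mulop: "dvar i = mulop (poly_var i)"
  by (rule diffop_eqI; simp add: apply_simps apply_mulop algebra_simps)+

lemma mulop_sum: "mulop (sum f A) = (\<Sum>x\<in>A. mulop (f x))"
  by (induction A rule: infinite_finite_induct) (simp_all add: mulop_0 mulop_add)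

lemma mulop_power: "mulop (p ^ k) = mulop p ^ k"
  by (induction k) (simp_all add: mulop_1 mulop_mult)

lemma mulop_prod_list: "mulop (prod_list ps) = prod_list (map mulop ps)"
  by (induction ps) (simp_all add: mulop_1 mulop_mult)

lemma mulop_scalar_commute: "mulop (Poly_Mapping.single 0 c) * a = a * mulop (Poly_Mapping.single 0 c)"
  by (rule diffop_eqI) (use apply_scale[of a c] in \<open>simp add: apply_simps apply_mulop poly_scale_def\<close>)

definition del :: "'n \<Rightarrow> ('n, 'k::field) diffop \<Rightarrow> ('n, 'k) diffop" where
  "del i a = a * dvar i - dvar i * a"

lemma del_add: "del i (a + b) = del i a + del i b"
  and del_mult: "del i (a * b) = del i a * b + a * del i b"
  by (simp_all add: del_def algebra_simps)

lemma del_mulop: "del i (mulop p) = 0"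
  by (simp add: del_def dvar_eq_mulop mult.commute flip: mulop_mult)

lemma del_dpart:
  "del i (dpart j k) = (if i = j \<and> k > 0 then dpart j (k - 1) else 0)"
  using ad_dpart_dvar[of k j i] by (cases "k = 0") (auto simp: del_def ad_def dpart_0)

lemma del_del: "del i (del j a) = del j (del i a)"
proof -
  have *: "dvar i * dvar j = (dvar j * dvar i :: ('a, 'b) diffop)"
    using ad_dvar_dvar[of i j] by (simp add: ad_def)
  then have "dvar i * (dvar j * a) = dvar j * (dvar i * a)" by (simp flip: mult.assoc)
  with * show ?thesis by (simp add: del_def algebra_simps)
qed

text \<open>
  The maps \<open>\<phi>\<^sub>i\<close> and \<open>\<psi>\<^sub>i\<close> are written with \<open>ad x\<^sub>i = - del i\<close>; this sign is the one in \<open>proj\<close>.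
\<close>

lemma ad_dvar_funpow: "(ad (dvar i) ^^ k) a = (- 1) ^ k * (del i ^^ k) a"
proof (induction k)
  case (Suc k)
  have "ad (dvar i) b = - del i b" for b :: "('a, 'b) diffop" by (simp add: ad_def del_def)
  moreover have "del i ((- 1) ^ k * b) = (- 1) ^ k * del i b" for b :: "('a, 'b) diffop"
    by (cases "even k") (simp_all add: del_def)
  ultimately show ?case using Suc by simp
qed simp

lemma del_nilpotent: "\<exists>M. (del i ^^ M) a = 0"
proof -
  obtain M where "(ad (dvar i) ^^ M) a = 0" using ad_dvar_nilpotent[of i a] by blast
  then have "(- 1) ^ M * ((- 1) ^ M * (del i ^^ M) a) = 0" by (simp add: ad_dvar_funpow)
  then have "(del i ^^ M) a = 0" by (cases "even M") simp_all
  then show ?thesis ..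
qed

lemma poly_mapping_sum_single:
  "(m :: 'n \<Rightarrow>\<^sub>0 nat) = (\<Sum>i \<in> Poly_Mapping.keys m. Poly_Mapping.single i (Poly_Mapping.lookup m i))"
  by (rule poly_mapping_eqI) (auto simp: lookup_sum lookup_single when_def sum.delta in_keys_iff)

text \<open>
  The polynomial algebra is its own centralizer in \<open>\<D>\<close>: an operator that commutes with the
  variables commutes with multiplication by all polynomials, so it is determined by its value at \<open>1\<close>.
\<close>

lemma eq_mulop_of_del_eq_0:
  assumes "\<And>i. del i a = 0"
  shows "a = mulop (apply_diffop a 1)"
proof (rule diffop_eqI)
  fix p
  define P where "P m \<longleftrightarrow> (\<forall>q. apply_diffop a (Poly_Mapping.single m 1 * q) =
    Poly_Mapping.single m 1 * apply_diffop a q)" for m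
  have add: "P (m + l)" if "P m" "P l" for m l
  proof -
    have "Poly_Mapping.single (m + l) (1 :: 'b) = Poly_Mapping.single m 1 * Poly_Mapping.single l 1"
      by (simp add: mult_single)
    then show ?thesis using that by (simp add: P_def mult.assoc)
  qed
  have zero: "P 0" by (simp add: P_def)
  have "a * dvar i = dvar i * a" for i using assms[of i] by (simp add: del_def)
  then have "apply_diffop (a * dvar i) q = apply_diffop (dvar i * a) q" for i q by simp
  then have one: "P (Poly_Mapping.single i 1)" for i by (simp add: P_def apply_simps poly_var_def)
  have single: "P (Poly_Mapping.single i k)" for i k
  proof (induction k)
    case (Suc k)
    then show ?case using add[OF one[of i] Suc] by (simp flip: single_add)
  qed (use zero in simp)
  have "P (\<Sum>i\<in>A. Poly_Mapping.single i (f i))" for A and f :: "'a \<Rightarrow> nat"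
    by (induction A rule: infinite_finite_induct) (simp_all add: zero add single)
  then have "P m" for m by (metis poly_mapping_sum_single)
  then have mono: "apply_diffop a (Poly_Mapping.single m 1 * q) =
      Poly_Mapping.single m 1 * apply_diffop a q" for m q
    by (simp add: P_def)
  have "apply_diffop a p = p * apply_diffop a 1"
  proof (rule additive_eq_on_monomials[of _ _ p])
    fix m :: "'a \<Rightarrow>\<^sub>0 nat" and c :: 'b
    have s: "Poly_Mapping.single m c = poly_scale c (Poly_Mapping.single m 1 * 1)"
      by (simp add: poly_scale_def mult_single)
    show "apply_diffop a (Poly_Mapping.single m c) = Poly_Mapping.single m c * apply_diffop a 1"
      unfolding s by (simp only: apply_scale mono) (simp add: poly_scale_def mult.assoc)
  qed (simp_all add: apply_add distrib_right)
  then show "apply_diffop a p = apply_diffop (mulop (apply_diffop a 1)) p"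
    by (simp add: apply_mulop mult.commute)
qed

section \<open>The projections onto the polynomials\<close>

definition lmul_dpart :: "'n \<Rightarrow> nat \<Rightarrow> ('n, 'k::field) diffop \<Rightarrow> ('n, 'k) diffop" where
  "lmul_dpart i k a = dpart i k * a"

definition rmul_dpart :: "'n \<Rightarrow> nat \<Rightarrow> ('n, 'k::field) diffop \<Rightarrow> ('n, 'k) diffop" where
  "rmul_dpart i k a = a * dpart i k"

lemma dpart_commute: "dpart i k * dpart j l = dpart j l * dpart i k"
  using ad_dpart_dpart[of i k j l] by (simp add: ad_def)

interpretation L: taylor_family del lmul_dpart
proof
  fix i j :: 'n and k l and x y :: "('n, 'k::field) diffop"
  show "lmul_dpart i k (lmul_dpart i l x) = of_nat (k + l choose k) * lmul_dpart i (k + l) x"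
    by (simp add: lmul_dpart_def dpart_mult flip: mult.assoc)
  show "i \<noteq> j \<Longrightarrow> lmul_dpart i l (lmul_dpart j k x) = lmul_dpart j k (lmul_dpart i l x)"
    by (simp add: lmul_dpart_def dpart_commute[of i l] flip: mult.assoc)
qed (simp_all add: lmul_dpart_def del_add del_mult del_del del_nilpotent del_dpart dpart_0 distrib_left)

interpretation R: taylor_family del rmul_dpart
proof
  fix i j :: 'n and k l and x y :: "('n, 'k::field) diffop"
  have "x * dpart i l * dpart i k = x * of_nat (k + l choose k) * dpart i (k + l)"
    by (simp only: mult.assoc dpart_commute[of i l i k] dpart_mult[of i k l])
  then show "rmul_dpart i k (rmul_dpart i l x) = of_nat (k + l choose k) * rmul_dpart i (k + l) x"
    by (simp add: rmul_dpart_def mult.assoc mult_of_nat_commute)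
  show "i \<noteq> j \<Longrightarrow> rmul_dpart i l (rmul_dpart j k x) = rmul_dpart j k (rmul_dpart i l x)"
    by (simp add: rmul_dpart_def dpart_commute[of i l] mult.assoc)
qed (simp_all add: rmul_dpart_def del_add del_mult del_del del_nilpotent del_dpart dpart_0 distrib_right)

lemma dvar'_id: "dvar' id = dvar" and dpart'_id: "dpart' id = dpart"
  by (simp_all add: fun_eq_iff dvar'_def dpart'_def)

lemma sign_mult_commute: "a * ((- 1) ^ k * b) = (- 1) ^ k * (a * b)" for a b :: "'a::ring_1"
  by (cases "even k") simp_all

lemma phi'_id: "phi' id i = L.proj i" and psi'_id: "psi' id i = R.proj i"
  by (simp_all add: fun_eq_iff phi'_def psi'_def L.proj_def R.proj_def dvar'_id dpart'_id
      ad_dvar_funpow lmul_dpart_def rmul_dpart_def mult.assoc sign_mult_commute)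

lemma hasse_deriv_one: "hasse_deriv i k 1 = (if k = 0 then 1 else 0)"
  by (cases k) (simp_all add: hasse_deriv_single flip: single_one)

lemma psi_apply_one: "apply_diffop (R.proj i a) 1 = apply_diffop a 1"
proof -
  obtain M where "(del i ^^ M) a = 0" using del_nilpotent[of i a] by blast
  then have "(del i ^^ Suc M) a = 0" by (simp add: R.E_zero)
  then show ?thesis
    by (simp add: R.proj_eq apply_sum_left apply_sign rmul_dpart_def sum.lessThan_Suc_shift
        apply_simps hasse_deriv_one apply_zero del: sum.lessThan_Suc funpow.simps(2))
qed

text \<open>
  The result commutes with all variables, and no \<open>\<psi>\<^sub>i\<close> changes the value at \<open>1\<close>, as \<open>\<partial>\<^sub>i\<^bsup>[k]\<^esup>\<close> kills
  \<open>1\<close> for \<open>k > 0\<close>. So the product of the \<open>\<psi>\<^sub>i\<close> is just evaluation at \<open>1\<close>.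
\<close>

lemma psi_all:
  "foldr R.proj (indices :: 'n::{finite,linorder} list) a = mulop (apply_diffop a (1 :: ('n, 'k::field) mpoly))"
proof -
  have "apply_diffop (foldr R.proj is a) 1 = apply_diffop a 1" for "is" :: "'n list"
    by (induction "is") (simp_all add: psi_apply_one)
  moreover have "foldr R.proj indices a = mulop (apply_diffop (foldr R.proj indices a) 1)"
    by (rule eq_mulop_of_del_eq_0) (simp add: R.E_projs)
  ultimately show ?thesis by simp
qed

text \<open>
  The projection along the right ideal \<open>\<Sum>\<^sub>i\<^sub>,\<^sub>k \<partial>\<^sub>i\<^bsup>[k]\<^esup> \<D>\<close>, \<open>k > 0\<close>. It carries the right \<open>\<D>\<close>-module structure
  of \<open>P\<^sub>n\<close> in which \<open>\<partial>\<^sub>i\<^bsup>[k]\<^esup>\<close> acts as \<open>(-1)\<^sup>k\<close> times the Hasse derivative (\<open>phi_poly_dpart\<close>).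
\<close>

definition phi_poly :: "('n::{finite,linorder}, 'k::field) diffop \<Rightarrow> ('n, 'k) mpoly" where
  "phi_poly a = apply_diffop (foldr L.proj indices a) 1"

lemma phi_all: "foldr L.proj indices a = mulop (phi_poly a)"
  unfolding phi_poly_def by (rule eq_mulop_of_del_eq_0) (simp add: L.E_projs)

text \<open>
  As \<open>r\<close> commutes with \<open>x\<^sub>i\<close>, the left side is \<open>\<Sum>\<^sub>j (-1)\<^sup>j \<partial>\<^sub>i\<^bsup>[j]\<^esup> r \<partial>\<^sub>i\<^bsup>[k-j]\<^esup>\<close>. It commutes with all variables,
  so it suffices to evaluate it at \<open>1\<close>, where only the term \<open>j = k\<close> survives.
\<close>

lemma phi_mulop_dpart:
  fixes r :: "('n, 'k::field) mpoly"
  shows "L.proj i (mulop r * dpart i k) = mulop ((- 1) ^ k * hasse_deriv i k r)"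
proof -
  let ?w = "mulop r * dpart i k"
  have pow: "(del i ^^ j) ?w = (if j \<le> k then mulop r * dpart i (k - j) else 0)" for j
    using R.E_funpow_T[where i = i and r = "mulop r" and j = j and k = k, OF del_mulop] by (simp add: rmul_dpart_def)
  have "(del i ^^ Suc k) ?w = 0" unfolding pow by simp
  then have "L.proj i ?w = (\<Sum>j<Suc k. (- 1) ^ j * lmul_dpart i j ((del i ^^ j) ?w))"
    by (rule L.proj_eq)
  also have "apply_diffop \<dots> 1 = (- 1) ^ k * hasse_deriv i k r"
    by (simp add: apply_sum_left apply_sign pow lmul_dpart_def apply_simps apply_mulop
        hasse_deriv_one apply_zero)
  finally have at_one: "apply_diffop (L.proj i ?w) 1 = (- 1) ^ k * hasse_deriv i k r" .
  have "del j (L.proj i ?w) = 0" for j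
    by (cases "j = i") (simp_all add: L.E_proj L.E_proj_neq del_mult del_mulop del_dpart L.proj_zero)
  from eq_mulop_of_del_eq_0[OF this] show ?thesis by (simp add: at_one)
qed

text \<open>
  By Taylor expansion \<open>a\<close> and \<open>\<phi>\<^sub>i a\<close> differ by an element of the right ideal generated by the \<open>\<partial>\<^sub>i\<^bsup>[k]\<^esup>\<close>
  with \<open>k > 0\<close>, and \<open>\<phi>\<^sub>i\<close> kills this right ideal.
\<close>

lemma phi_mult_right: "L.proj i (a * b) = L.proj i (L.proj i a * b)"
proof -
  obtain M where "(del i ^^ M) a = 0" using del_nilpotent[of i a] by blast
  then have "(del i ^^ Suc M) a = 0" by (simp add: L.E_zero)
  from L.taylor[OF this]
  have "a * b = (\<Sum>k<Suc M. lmul_dpart i k (L.proj i ((del i ^^ k) a))) * b" by simp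
  also have "\<dots> = (\<Sum>k<Suc M. lmul_dpart i k (L.proj i ((del i ^^ k) a) * b))"
    by (simp add: sum_distrib_right lmul_dpart_def mult.assoc del: sum.lessThan_Suc)
  also have "L.proj i \<dots> = L.proj i (L.proj i a * b)"
    by (simp add: L.proj_add L.proj_sum sum.lessThan_Suc_shift L.proj_T L.T_0 del: sum.lessThan_Suc)
  finally show ?thesis .
qed

lemma phi_mult_dpart: "i \<noteq> j \<Longrightarrow> L.proj j (a * dpart i k) = L.proj j a * dpart i k"
  by (rule L.proj_commute[symmetric])
    (simp_all add: distrib_right del_mult del_dpart lmul_dpart_def mult.assoc)

text \<open>
  The factors other than \<open>\<phi>\<^sub>i\<close> pass through the right multiplication by \<open>\<partial>\<^sub>i\<^bsup>[k]\<^esup>\<close>, and they commute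
  with \<open>\<phi>\<^sub>i\<close>, whose argument may be projected first.
\<close>

lemma phi_list_mult_dpart:
  assumes "distinct is" "i \<in> set is"
  shows "foldr L.proj is (a * dpart i k) = L.proj i (foldr L.proj is a * dpart i k)"
  using assms
proof (induction "is")
  case (Cons j js)
  show ?case
  proof (cases "j = i")
    case True
    have "foldr L.proj js (a * dpart i k) = foldr L.proj js a * dpart i k"
      using Cons.prems True by (induction js) (auto simp: phi_mult_dpart)
    then show ?thesis using True phi_mult_right by simp
  next
    case False
    then show ?thesis using Cons by (simp add: L.proj_proj[of j i] phi_mult_dpart)
  qed
qed simp

lemma phi_poly_dpart: "phi_poly (a * dpart i k) = (- 1) ^ k * hasse_deriv i k (phi_poly a)"
proof -
  have "foldr L.proj indices (a * dpart i k) = mulop ((- 1) ^ k * hasse_deriv i k (phi_poly a))"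
    using phi_list_mult_dpart[of indices i a k] by (simp add: phi_all phi_mulop_dpart)
  then show ?thesis by (simp add: phi_poly_def apply_mulop)
qed

section \<open>Coefficients\<close>

lemma lookup_hasse_deriv:
  "Poly_Mapping.lookup (hasse_deriv i k p) m =
    of_nat (Poly_Mapping.lookup m i + k choose k) * Poly_Mapping.lookup p (m + Poly_Mapping.single i k)"
proof -
  let ?e = "Poly_Mapping.single i k"
  have "Poly_Mapping.lookup (hasse_deriv i k p) m = (\<Sum>l\<in>Poly_Mapping.keys p.
      (of_nat (Poly_Mapping.lookup l i choose k) * Poly_Mapping.lookup p l when l - ?e = m))"
    by (simp add: hasse_deriv_def lookup_sum lookup_single)
  also have "\<dots> = (\<Sum>l\<in>Poly_Mapping.keys p. if l = m + ?e then
      of_nat (Poly_Mapping.lookup m i + k choose k) * Poly_Mapping.lookup p (m + ?e) else 0)"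
  proof (rule sum.cong[OF refl])
    fix l
    have "Poly_Mapping.lookup l i < k" if "l - ?e = m" "l \<noteq> m + ?e"
    proof (rule ccontr)
      assume "\<not> ?thesis"
      then have "l = l - ?e + ?e"
        by (intro poly_mapping_eqI) (auto simp: lookup_add lookup_minus lookup_single when_def)
      with that show False by simp
    qed
    then show "(of_nat (Poly_Mapping.lookup l i choose k) * Poly_Mapping.lookup p l when l - ?e = m) =
        (if l = m + ?e then of_nat (Poly_Mapping.lookup m i + k choose k) * Poly_Mapping.lookup p (m + ?e) else 0)"
      by (auto simp: when_def binomial_eq_0 lookup_add)
  qed
  also have "\<dots> = of_nat (Poly_Mapping.lookup m i + k choose k) * Poly_Mapping.lookup p (m + ?e)"
    by (simp add: sum.delta in_keys_iff)
  finally show ?thesis .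
qed

lemma lookup_sign: "Poly_Mapping.lookup ((- 1) ^ k * p) m = (- 1) ^ k * Poly_Mapping.lookup p m"
  for p :: "('n, 'k::field) mpoly"
  by (cases "even k") (simp_all add: lookup_uminus)

text \<open>
  Conversion between the two encodings of exponents: plain functions in the multi-indices of the
  formulas, finitely supported ones in polynomials.
\<close>

definition exponent :: "('n::finite \<Rightarrow> nat) \<Rightarrow> 'n \<Rightarrow>\<^sub>0 nat" where
  "exponent \<alpha> = Abs_poly_mapping \<alpha>"

lemma lookup_exponent: "Poly_Mapping.lookup (exponent \<alpha>) = \<alpha>"
  by (simp add: exponent_def)

lemma sum_list_indices: "sum_list (map f (indices :: 'n::{finite,linorder} list)) = sum f UNIV"
  using sum_list_distinct_conv_sum_set[of "indices :: 'n list" f] by simp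

lemma sum_list_single:
  "sum_list (map (\<lambda>i. Poly_Mapping.single i (\<alpha> i)) indices) = exponent \<alpha>"
  unfolding sum_list_indices
  by (rule poly_mapping_eqI) (simp add: lookup_sum lookup_single lookup_exponent when_def)

text \<open>
  The Hasse derivative \<open>\<partial>\<^bsup>[\<alpha>]\<^esup>\<close> moves the coefficient at \<open>x\<^sup>\<alpha>\<close> to the constant term, with factor \<open>1\<close>:
  this is how constant terms give access to all coefficients.
\<close>

lemma coeff_psi:
  fixes \<alpha> :: "'a::{finite,linorder} \<Rightarrow> nat" and a :: "('a, 'b::field) diffop"
  shows "Poly_Mapping.lookup (apply_diffop (monom_dpart \<alpha> * a) 1) 0 =
    Poly_Mapping.lookup (apply_diffop a 1) (exponent \<alpha>)"
proof -
  have "Poly_Mapping.lookup (apply_diffop (prod_list (map (\<lambda>i. dpart i (\<alpha> i)) is)) p) m =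
      Poly_Mapping.lookup p (m + sum_list (map (\<lambda>i. Poly_Mapping.single i (\<alpha> i)) is))"
    if "distinct is" "\<And>i. i \<in> set is \<Longrightarrow> Poly_Mapping.lookup m i = 0"
    for "is" :: "'a list" and p :: "('a, 'b) mpoly" and m
    using that
  proof (induction "is" arbitrary: m)
    case (Cons i js)
    have "Poly_Mapping.lookup (m + Poly_Mapping.single i (\<alpha> i)) j = 0" if "j \<in> set js" for j
      using that Cons.prems by (auto simp: lookup_add lookup_single when_def)
    then show ?case
      using Cons by (simp add: apply_simps lookup_hasse_deriv add.assoc)
  qed (simp add: apply_simps)
  from this[of indices 0] show ?thesis
    by (simp add: monom_dpart_def sum_list_single apply_simps)
qed

lemma coeff_phi:
  fixes \<alpha> :: "'a::{finite,linorder} \<Rightarrow> nat" and a :: "('a, 'b::field) diffop"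
  shows "Poly_Mapping.lookup (phi_poly (a * monom_dpart \<alpha>)) 0 =
    (- 1) ^ (\<Sum>i\<in>UNIV. \<alpha> i) * Poly_Mapping.lookup (phi_poly a) (exponent \<alpha>)"
proof -
  have zero: "Poly_Mapping.lookup (sum_list (map (\<lambda>i. Poly_Mapping.single i (\<alpha> i)) js)) i = 0"
    if "i \<notin> set js" for i and js :: "'a list"
    using that by (induction js) (auto simp: lookup_add lookup_single)
  have "Poly_Mapping.lookup (phi_poly (a * prod_list (map (\<lambda>i. dpart i (\<alpha> i)) is))) 0 =
      (- 1) ^ sum_list (map \<alpha> is) *
        Poly_Mapping.lookup (phi_poly a) (sum_list (map (\<lambda>i. Poly_Mapping.single i (\<alpha> i)) is))"
    if "distinct is" for "is" :: "'a list" and a :: "('a, 'b) diffop"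
    using that
  proof (induction "is" arbitrary: a)
    case (Cons i js)
    from Cons.prems have "distinct js" "i \<notin> set js" by auto
    have "Poly_Mapping.lookup (phi_poly (a * prod_list (map (\<lambda>i. dpart i (\<alpha> i)) (i # js)))) 0 =
      (- 1) ^ sum_list (map \<alpha> js) * Poly_Mapping.lookup (phi_poly (a * dpart i (\<alpha> i)))
        (sum_list (map (\<lambda>i. Poly_Mapping.single i (\<alpha> i)) js))"
      using Cons.IH[OF \<open>distinct js\<close>, of "a * dpart i (\<alpha> i)"] by (simp add: mult.assoc)
    then show ?case
      by (simp add: phi_poly_dpart lookup_sign lookup_hasse_deriv zero[OF \<open>i \<notin> set js\<close>]
          power_add add.commute mult_ac)
  qed simp
  from this[of indices a] show ?thesis
    by (simp add: monom_dpart_def sum_list_single sum_list_indices)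
qed

lemma poly_var_power: "poly_var i ^ k = Poly_Mapping.single (Poly_Mapping.single i k) 1"
  by (induction k) (simp_all add: poly_var_def mult_single flip: single_add)

lemma monom_dvar_eq:
  fixes \<alpha> :: "'a::{finite,linorder} \<Rightarrow> nat"
  shows "(monom_dvar \<alpha> :: ('a, 'b::field) diffop) = mulop (Poly_Mapping.single (exponent \<alpha>) 1)"
proof -
  have "prod_list (map (\<lambda>i. Poly_Mapping.single (Poly_Mapping.single i (\<alpha> i)) (1 :: 'b)) is) =
      Poly_Mapping.single (sum_list (map (\<lambda>i. Poly_Mapping.single i (\<alpha> i)) is)) 1"
    for "is" :: "'a list"
    by (induction "is") (simp_all add: mult_single)
  then have "Poly_Mapping.single (exponent \<alpha>) (1 :: 'b) = prod_list (map (\<lambda>i. poly_var i ^ \<alpha> i) indices)"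
    by (simp add: poly_var_power sum_list_single)
  then show ?thesis
    by (simp add: monom_dvar_def mulop_prod_list mulop_power dvar_eq_mulop o_def)
qed

section \<open>Extraction of the constant term in positive characteristic\<close>

text \<open>
  Compare the powers of \<open>q\<close> on both sides of \<open>a (n choose a) = n (n-1 choose a-1)\<close>.
\<close>

lemma prime_dvd_choose:
  fixes q :: nat
  assumes "prime q" "q ^ k dvd n" "0 < a" "a < q ^ k"
  shows "q dvd (n choose a)"
proof (rule ccontr)
  assume "\<not> q dvd (n choose a)"
  then have "coprime (q ^ k) (n choose a)"
    using assms(1) by (simp add: prime_imp_coprime)
  moreover have "q ^ k dvd a * (n choose a)"
    using assms times_binomial_minus1_eq[of a n] by simp
  ultimately have "q ^ k dvd a" by (simp add: coprime_dvd_mult_left_iff)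
  then show False using assms by (auto dest: dvd_imp_le)
qed

lemma CHAR_prime_field: "CHAR('k::field) > 0 \<Longrightarrow> prime CHAR('k)"
  by (rule prime_CHAR_semidom)

lemma of_nat_choose_eq_0:
  assumes "CHAR('k::field) > 0" "CHAR('k) ^ k dvd n" "0 < a" "a < CHAR('k) ^ k"
  shows "of_nat (n choose a) = (0 :: 'k)"
  unfolding of_nat_eq_0_iff_char_dvd
  by (rule prime_dvd_choose[OF CHAR_prime_field[OF assms(1)] assms(2-4)])

text \<open>
  A case of Lucas' theorem, from Vandermonde's identity for \<open>p\<^sup>k t + p\<^sup>k\<close>, in which only the
  extreme terms survive.
\<close>

lemma of_nat_choose_CHAR_power:
  assumes "CHAR('k::field) > 0"
  shows "of_nat (CHAR('k) ^ k * t choose CHAR('k) ^ k) = (of_nat t :: 'k)"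
proof (induction t)
  case (Suc t)
  let ?q = "CHAR('k) ^ k"
  have "of_nat (?q * Suc t choose ?q) =
      (\<Sum>a\<le>?q. of_nat ((?q * t choose a) * (?q choose (?q - a))) :: 'k)"
    unfolding of_nat_sum[symmetric] vandermonde by (simp add: add.commute)
  also have "\<dots> = (\<Sum>a\<in>{0, ?q}. of_nat ((?q * t choose a) * (?q choose (?q - a))))"
    by (rule sum.mono_neutral_right)
      (auto simp: of_nat_choose_eq_0[OF assms, of k] assms le_less)
  also have "\<dots> = of_nat (Suc t)" using Suc assms by simp
  finally show ?case .
qed (use assms in \<open>simp add: binomial_eq_0\<close>)

text \<open>
  Modulo \<open>p\<close> the truncated alternating sum is periodic in \<open>t\<close> with period \<open>p\<close>, and for \<open>t < p\<close>
  nothing is truncated.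
\<close>

lemma alternating_choose_sum:
  assumes "CHAR('k::field) > 0"
  shows "(\<Sum>j<CHAR('k). (- 1) ^ j * of_nat (t choose j)) = (if CHAR('k) dvd t then 1 else 0 :: 'k)"
proof -
  let ?p = "CHAR('k)"
  have periodic: "of_nat (t + ?p choose j) = (of_nat (t choose j) :: 'k)" if "j < ?p" for t j
  proof -
    have "of_nat (t + ?p choose j) = (\<Sum>a\<le>j. of_nat ((?p choose a) * (t choose (j - a))) :: 'k)"
      unfolding of_nat_sum[symmetric] vandermonde by (simp add: add.commute)
    also have "\<dots> = (\<Sum>a\<in>{0}. of_nat ((?p choose a) * (t choose (j - a))))"
      by (rule sum.mono_neutral_right)
        (use that in \<open>auto simp: of_nat_choose_eq_0[OF assms, of 1]\<close>)
    finally show ?thesis by simp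
  qed
  show ?thesis
  proof (induction t rule: less_induct)
    case (less t)
    show ?case
    proof (cases "t < ?p")
      case True
      have "(\<Sum>j<?p. (- 1) ^ j * of_nat (t choose j)) = (\<Sum>j\<le>t. (- 1) ^ j * of_nat (t choose j) :: 'k)"
        by (rule sum.mono_neutral_right) (use True in \<open>auto simp: binomial_eq_0\<close>)
      also have "\<dots> = (if t = 0 then 1 else 0)" using choose_alternating_sum[of t, where ?'a = 'k] by simp
      finally show ?thesis using True by (auto dest: dvd_imp_le)
    next
      case False
      then obtain s where s: "t = s + ?p" by (metis add.commute le_Suc_ex not_less)
      then show ?thesis using less[of s] assms by (simp add: periodic)
    qed
  qed
qed

definition restr :: "(('n \<Rightarrow>\<^sub>0 nat) \<Rightarrow> bool) \<Rightarrow> ('n, 'k::field) mpoly \<Rightarrow> ('n, 'k) mpoly" where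
  "restr P f = (\<Sum>m | m \<in> Poly_Mapping.keys f \<and> P m. Poly_Mapping.single m (Poly_Mapping.lookup f m))"

lemma lookup_restr:
  "Poly_Mapping.lookup (restr P f) m = (if P m then Poly_Mapping.lookup f m else 0)"
  by (simp add: restr_def lookup_sum lookup_single when_def sum.delta in_keys_iff)

lemma ad_dpart_mulop:
  assumes "q > 0" "\<And>a. 0 < a \<Longrightarrow> a < q \<Longrightarrow> hasse_deriv i a f = 0"
  shows "ad (dpart i q) (mulop f) = mulop (hasse_deriv i q f)"
proof (rule diffop_eqI)
  fix r
  have "hasse_deriv i q (f * r) = (\<Sum>a\<in>{0, q}. hasse_deriv i a f * hasse_deriv i (q - a) r)"
    unfolding hasse_deriv_leibniz
    by (rule sum.mono_neutral_right) (auto simp: assms le_less)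
  then show "apply_diffop (ad (dpart i q) (mulop f)) r = apply_diffop (mulop (hasse_deriv i q f)) r"
    using assms(1) by (simp add: ad_def apply_simps apply_mulop)
qed

lemma Suc_times_choose_Suc: "Suc j * (t choose Suc j) = (t - j) * (t choose j)"
  by (cases t) (simp_all add: Suc_times_binomial binomial_absorb_comp del: binomial_Suc_Suc mult_Suc)

text \<open>
  On polynomials in \<open>x\<^sub>i\<^sup>q\<close> with \<open>q = p\<^sup>k\<close>, the Hasse derivatives of orders strictly between \<open>0\<close> and \<open>q\<close>
  vanish, so \<open>ad \<partial>\<^sub>i\<^bsup>[q]\<^esup>\<close> acts as the Hasse derivative of order \<open>q\<close>, which is \<open>d/dy\<close> in the variable
  \<open>y = x\<^sub>i\<^sup>q\<close>.
\<close>

lemma ad_dpart_funpow_single: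
  fixes c :: "'k::field"
  assumes "CHAR('k) > 0" "Poly_Mapping.lookup m i = CHAR('k) ^ k * t"
  shows "(ad (dpart i (CHAR('k) ^ k)) ^^ j) (mulop (Poly_Mapping.single m c)) =
    mulop (Poly_Mapping.single (m - Poly_Mapping.single i (CHAR('k) ^ k * j))
      (of_nat (fact j * (t choose j)) * c))"
proof (induction j)
  case (Suc j)
  let ?q = "CHAR('k) ^ k"
  let ?m = "m - Poly_Mapping.single i (?q * j)"
  let ?c = "of_nat (fact j * (t choose j)) * c"
  have l: "Poly_Mapping.lookup ?m i = ?q * (t - j)"
    using assms by (simp add: lookup_minus right_diff_distrib')
  have "hasse_deriv i a (Poly_Mapping.single ?m ?c) = 0" if "0 < a" "a < ?q" for a
    using of_nat_choose_eq_0[OF assms(1), of k "?q * (t - j)" a] that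
    by (simp add: hasse_deriv_single l)
  then have "ad (dpart i ?q) (mulop (Poly_Mapping.single ?m ?c)) =
      mulop (hasse_deriv i ?q (Poly_Mapping.single ?m ?c))"
    by (intro ad_dpart_mulop) (use assms in auto)
  also have "hasse_deriv i ?q (Poly_Mapping.single ?m ?c) =
      Poly_Mapping.single (?m - Poly_Mapping.single i ?q) (of_nat (t - j) * ?c)"
    by (simp add: hasse_deriv_single l of_nat_choose_CHAR_power assms)
  also have "of_nat (t - j) * ?c = of_nat (fact (Suc j) * (t choose Suc j)) * c"
  proof -
    have "(t - j) * (fact j * (t choose j)) = fact (Suc j) * (t choose Suc j)"
      using Suc_times_choose_Suc[of j t]
      by (simp only: fact_Suc of_nat_id) (metis mult.assoc mult.commute)
    then show ?thesis by (metis mult.assoc of_nat_mult)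
  qed
  also have "?m - Poly_Mapping.single i ?q = m - Poly_Mapping.single i (?q * Suc j)"
    by (rule poly_mapping_eqI) (simp add: lookup_minus lookup_single when_def add.commute)
  finally show ?case using Suc by simp
qed (simp add: poly_mapping_eqI lookup_minus)

lemma diffop_scale_mulop: "diffop_scale s (mulop f) = mulop (Poly_Mapping.single 0 s * f)"
  by (rule diffop_eqI) (simp add: diffop_scale.rep_eq apply_mulop poly_scale_def mult.assoc)

lemma diffop_scale_mult: "diffop_scale s a = mulop (Poly_Mapping.single 0 s) * a"
  by (rule diffop_eqI) (simp add: diffop_scale.rep_eq apply_mulop poly_scale_def apply_simps)

lemma phi_const_step_add:
  "phi_const_step' \<sigma> i k (a + b) = phi_const_step' \<sigma> i k a + phi_const_step' \<sigma> i k b"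
proof -
  have "(ad r ^^ j) (a + b) = (ad r ^^ j) a + (ad r ^^ j) b" for r j
    by (induction j) (simp_all add: ad_def algebra_simps)
  then show ?thesis
    by (simp add: phi_const_step'_def diffop_scale_mult distrib_left sum.distrib)
qed

lemma phi_const_step_sum:
  "phi_const_step' \<sigma> i k (sum h A) = (\<Sum>m\<in>A. phi_const_step' \<sigma> i k (h m))"
proof -
  have "phi_const_step' \<sigma> i k 0 = 0" using phi_const_step_add[of \<sigma> i k 0 0] by simp
  then show ?thesis
    by (induction A rule: infinite_finite_induct) (simp_all add: phi_const_step_add)
qed

text \<open>
  With \<open>y = x\<^sub>i\<^bsup>p^k\<^esup>\<close> the map is \<open>\<Sum>\<^sub>j\<^sub><\<^sub>p (-y)\<^sup>j / j! (d/dy)\<^sup>j\<close>. It multiplies \<open>y\<^sup>t\<close> by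
  \<open>\<Sum>\<^sub>j\<^sub><\<^sub>p (-1)\<^sup>j (t choose j)\<close>, which is \<open>1\<close> if \<open>p\<close> divides \<open>t\<close> and \<open>0\<close> otherwise.
\<close>

lemma phi_const_step_single:
  fixes c :: "'k::field"
  assumes "CHAR('k) > 0" "CHAR('k) ^ k dvd Poly_Mapping.lookup m i"
  shows "phi_const_step' id i k (mulop (Poly_Mapping.single m c)) =
    (if CHAR('k) ^ Suc k dvd Poly_Mapping.lookup m i then mulop (Poly_Mapping.single m c) else 0)"
proof -
  let ?p = "CHAR('k)" and ?q = "CHAR('k) ^ k"
  obtain t where t: "Poly_Mapping.lookup m i = ?q * t" using assms(2) by blast
  have "diffop_scale ((- 1) ^ j / of_nat (fact j))
        (dvar i ^ (?q * j) * (ad (dpart i ?q) ^^ j) (mulop (Poly_Mapping.single m c))) =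
      mulop (Poly_Mapping.single m ((- 1) ^ j * of_nat (t choose j) * c))" if "j < ?p" for j
  proof (cases "j \<le> t")
    case True
    have "of_nat (fact j) \<noteq> (0 :: 'k)"
      using prime_dvd_fact_iff[OF CHAR_prime_field[OF assms(1)], of j] that
      by (simp add: of_nat_eq_0_iff_char_dvd del: of_nat_fact)
    moreover have "Poly_Mapping.single i (?q * j) + (m - Poly_Mapping.single i (?q * j)) = m"
      using mult_le_mono2[OF True, of ?q] t
      by (intro poly_mapping_eqI) (auto simp: lookup_add lookup_minus lookup_single when_def)
    ultimately show ?thesis
      by (simp add: ad_dpart_funpow_single[OF assms(1) t] dvar_eq_mulop poly_var_power mult_single
          diffop_scale_mulop mult.assoc
          flip: mulop_power mulop_mult)
  next
    case False
    then show ?thesis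
      by (simp add: ad_dpart_funpow_single[OF assms(1) t] diffop_scale_mult mulop_0 binomial_eq_0)
  qed
  then have "phi_const_step' id i k (mulop (Poly_Mapping.single m c)) =
      (\<Sum>j<?p. mulop (Poly_Mapping.single m ((- 1) ^ j * of_nat (t choose j) * c)))"
    by (simp add: phi_const_step'_def dvar'_id dpart'_id)
  also have "\<dots> = mulop (Poly_Mapping.single m ((\<Sum>j<?p. (- 1) ^ j * of_nat (t choose j)) * c))"
  proof -
    have "Poly_Mapping.single m (sum h A) = (\<Sum>j\<in>A. Poly_Mapping.single m (h j))"
      for h :: "nat \<Rightarrow> 'k" and A
      by (induction A rule: infinite_finite_induct) (simp_all add: single_add)
    then show ?thesis by (simp add: sum_distrib_right mulop_sum)
  qed
  also have "\<dots> = (if ?p dvd t then mulop (Poly_Mapping.single m c) else 0)"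
    by (simp add: alternating_choose_sum[OF assms(1)] mulop_0)
  finally show ?thesis using t assms(1) by (simp add: mult.commute)
qed

lemma phi_const_step_mulop:
  fixes f :: "('n::{finite,linorder}, 'k::field) mpoly"
  assumes "CHAR('k) > 0" "\<And>m. m \<in> Poly_Mapping.keys f \<Longrightarrow> CHAR('k) ^ k dvd Poly_Mapping.lookup m i"
  shows "phi_const_step' id i k (mulop f) =
    mulop (restr (\<lambda>m. CHAR('k) ^ Suc k dvd Poly_Mapping.lookup m i) f)"
proof -
  have "mulop f = (\<Sum>m\<in>Poly_Mapping.keys f. mulop (Poly_Mapping.single m (Poly_Mapping.lookup f m)))"
    by (subst mpoly_sum_monomials) (rule mulop_sum)
  then have "phi_const_step' id i k (mulop f) = (\<Sum>m\<in>Poly_Mapping.keys f.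
      if CHAR('k) ^ Suc k dvd Poly_Mapping.lookup m i
      then mulop (Poly_Mapping.single m (Poly_Mapping.lookup f m)) else 0)"
    by (simp only: phi_const_step_sum phi_const_step_single[OF assms] cong: sum.cong)
  also have "\<dots> = mulop (restr (\<lambda>m. CHAR('k) ^ Suc k dvd Poly_Mapping.lookup m i) f)"
    by (simp add: restr_def mulop_sum sum.inter_filter if_distrib[of mulop] mulop_0 cong: if_cong)
  finally show ?thesis .
qed

lemma phi_const_steps:
  fixes f :: "('n::{finite,linorder}, 'k::field) mpoly"
  assumes "CHAR('k) > 0"
  shows "fold (phi_const_step' id i) [0..<N] (mulop f) =
    mulop (restr (\<lambda>m. CHAR('k) ^ N dvd Poly_Mapping.lookup m i) f)"
proof (induction N)
  case 0
  have "restr (\<lambda>m. True) f = f" by (rule poly_mapping_eqI) (simp add: lookup_restr)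
  then show ?case by simp
next
  case (Suc N)
  have "phi_const_step' id i N (mulop (restr (\<lambda>m. CHAR('k) ^ N dvd Poly_Mapping.lookup m i) f)) =
     mulop (restr (\<lambda>m. CHAR('k) ^ Suc N dvd Poly_Mapping.lookup m i)
       (restr (\<lambda>m. CHAR('k) ^ N dvd Poly_Mapping.lookup m i) f))"
    by (rule phi_const_step_mulop[OF assms]) (auto simp: in_keys_iff lookup_restr split: if_splits)
  also have "restr (\<lambda>m. CHAR('k) ^ Suc N dvd Poly_Mapping.lookup m i)
       (restr (\<lambda>m. CHAR('k) ^ N dvd Poly_Mapping.lookup m i) f) =
     restr (\<lambda>m. CHAR('k) ^ Suc N dvd Poly_Mapping.lookup m i) f"
    by (rule poly_mapping_eqI) (auto simp: lookup_restr dest: dvd_mult_right)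
  finally show ?case using Suc by simp
qed

text \<open>
  A bounded exponent that is divisible by a large power of \<open>p\<close> is zero.
\<close>

lemma phi_const_steps_eventually:
  fixes f :: "('n::{finite,linorder}, 'k::field) mpoly"
  assumes "CHAR('k) > 0"
  shows "eventually (\<lambda>N. fold (phi_const_step' id i) [0..<N] (mulop f) =
    mulop (restr (\<lambda>m. Poly_Mapping.lookup m i = 0) f)) sequentially"
proof (rule eventually_sequentiallyI)
  fix N
  assume N: "(\<Sum>m\<in>Poly_Mapping.keys f. Poly_Mapping.lookup m i) \<le> N"
  have *: "CHAR('k) ^ N dvd Poly_Mapping.lookup m i \<longleftrightarrow> Poly_Mapping.lookup m i = 0"
    if "m \<in> Poly_Mapping.keys f" for m
  proof -
    have "Poly_Mapping.lookup m i \<le> N"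
      using member_le_sum[OF that, of "\<lambda>m. Poly_Mapping.lookup m i"] N by simp
    also have "N < 2 ^ N" by (rule less_exp)
    also have "\<dots> \<le> CHAR('k) ^ N"
      using prime_ge_2_nat[OF CHAR_prime_field[OF assms]] by (rule power_mono) simp
    finally show ?thesis by (auto dest: dvd_imp_le)
  qed
  have "restr (\<lambda>m. CHAR('k) ^ N dvd Poly_Mapping.lookup m i) f =
      restr (\<lambda>m. Poly_Mapping.lookup m i = 0) f"
  proof (intro poly_mapping_eqI)
    fix m
    show "Poly_Mapping.lookup (restr (\<lambda>m. CHAR('k) ^ N dvd Poly_Mapping.lookup m i) f) m =
        Poly_Mapping.lookup (restr (\<lambda>m. Poly_Mapping.lookup m i = 0) f) m"
      using * by (cases "m \<in> Poly_Mapping.keys f") (simp_all add: lookup_restr in_keys_iff)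
  qed
  then show "fold (phi_const_step' id i) [0..<N] (mulop f) =
      mulop (restr (\<lambda>m. Poly_Mapping.lookup m i = 0) f)"
    by (simp add: phi_const_steps[OF assms])
qed

section \<open>Conjugation by an automorphism\<close>

text \<open>
  The primed maps are the conjugates under \<open>\<sigma>\<close> of the maps for \<open>\<sigma> = id\<close>, and on scalars, where
  \<open>\<phi>\<^sub>\<sigma>\<close> and \<open>\<psi>\<^sub>\<sigma>\<close> take their values, \<open>\<sigma>\<close> is the identity.
\<close>

locale diffop_aut =
  fixes \<sigma> :: "('n::{finite, linorder}, 'k::field) diffop \<Rightarrow> ('n, 'k) diffop"
  assumes aut: "diffop_automorphism \<sigma>"
begin

lemma mult: "\<sigma> (a * b) = \<sigma> a * \<sigma> b" and one: "\<sigma> 1 = 1" and bij: "bij \<sigma>"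
  using aut by (auto simp: diffop_automorphism_def)

lemma linear: "Vector_Spaces.linear diffop_scale diffop_scale \<sigma>"
  using aut by (simp add: diffop_automorphism_def)

lemma zero: "\<sigma> 0 = 0" and minus: "\<sigma> (- a) = - \<sigma> a" and diff: "\<sigma> (a - b) = \<sigma> a - \<sigma> b"
  and scale: "\<sigma> (diffop_scale c a) = diffop_scale c (\<sigma> a)"
  and sum: "\<sigma> (sum f A) = (\<Sum>x\<in>A. \<sigma> (f x))"
proof -
  interpret Vector_Spaces.linear diffop_scale diffop_scale \<sigma> by (rule linear)
  show "\<sigma> 0 = 0" "\<sigma> (- a) = - \<sigma> a" "\<sigma> (a - b) = \<sigma> a - \<sigma> b"
    "\<sigma> (diffop_scale c a) = diffop_scale c (\<sigma> a)" "\<sigma> (sum f A) = (\<Sum>x\<in>A. \<sigma> (f x))"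
    by (rule zero neg diff scale sum)+
qed

lemma power: "\<sigma> (a ^ k) = \<sigma> a ^ k"
  by (induction k) (simp_all add: one mult)

lemma prod_list: "\<sigma> (prod_list as) = prod_list (map \<sigma> as)"
  by (induction as) (simp_all add: one mult)

lemma Sum_any: "Sum_any (\<lambda>k. \<sigma> (g k)) = \<sigma> (Sum_any g)"
proof -
  have "\<sigma> a = 0 \<longleftrightarrow> a = 0" for a
    using bij zero by (metis bij_is_inj injD)
  then show ?thesis by (simp add: Sum_any.expand_set sum)
qed

lemma ad_funpow: "(ad (\<sigma> r) ^^ k) (\<sigma> a) = \<sigma> ((ad r ^^ k) a)"
  by (induction k) (simp_all add: ad_def diff mult)

lemma phi': "phi' \<sigma> i (\<sigma> a) = \<sigma> (L.proj i a)"
  unfolding phi'_id[symmetric]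
  by (simp add: phi'_def dvar'_def dpart'_def ad_funpow Sum_any flip: mult)

lemma psi': "psi' \<sigma> i (\<sigma> a) = \<sigma> (R.proj i a)"
  unfolding psi'_id[symmetric]
  by (simp add: psi'_def dvar'_def dpart'_def ad_funpow Sum_any flip: mult)

lemma phi_const_step': "phi_const_step' \<sigma> i k (\<sigma> a) = \<sigma> (phi_const_step' id i k a)"
  by (simp add: phi_const_step'_def dvar'_def dpart'_def ad_funpow scale sum mult power)

lemma delta': "delta' \<sigma> \<beta> (\<sigma> a) = \<sigma> (foldr (\<lambda>i. del i ^^ \<beta> i) indices a)"
proof -
  have "- ad (dvar' \<sigma> i) (\<sigma> a) = \<sigma> (del i a)" for i a
    by (simp add: ad_def del_def dvar'_def diff mult)
  then have "((\<lambda>a. - ad (dvar' \<sigma> i) a) ^^ k) (\<sigma> a) = \<sigma> ((del i ^^ k) a)" for i k a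
    by (induction k) simp_all
  then have "foldr (\<lambda>i. (\<lambda>a. - ad (dvar' \<sigma> i) a) ^^ \<beta> i) is (\<sigma> a) =
      \<sigma> (foldr (\<lambda>i. del i ^^ \<beta> i) is a)" for "is"
    by (induction "is") simp_all
  then show ?thesis by (simp add: delta'_def)
qed

lemma monom_dpart': "monom_dpart' \<sigma> \<alpha> = \<sigma> (monom_dpart \<alpha>)"
  by (simp add: monom_dpart'_def monom_dpart_def prod_list dpart'_def o_def)

text \<open>
  The partial products for \<open>\<sigma>\<close> are the images of those for \<open>id\<close>, so they stabilize too, and the
  value at which a sequence stabilizes is unique.
\<close>

lemma phi_const':
  assumes "CHAR('k) > 0"
  shows "phi_const' \<sigma> i (\<sigma> (mulop f)) = \<sigma> (mulop (restr (\<lambda>m. Poly_Mapping.lookup m i = 0) f))"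
    (is "_ = ?b")
proof -
  have "fold (phi_const_step' \<sigma> i) ks (\<sigma> a) = \<sigma> (fold (phi_const_step' id i) ks a)" for ks a
    by (induction ks arbitrary: a) (simp_all add: phi_const_step')
  then have ev: "eventually (\<lambda>N. fold (phi_const_step' \<sigma> i) [0..<N] (\<sigma> (mulop f)) = ?b) sequentially"
    using phi_const_steps_eventually[OF assms, of i f] by (auto elim: eventually_mono)
  show ?thesis
    unfolding phi_const'_def
  proof (rule the_equality)
    fix b assume "eventually (\<lambda>N. fold (phi_const_step' \<sigma> i) [0..<N] (\<sigma> (mulop f)) = b) sequentially"
    from eventually_happens[OF eventually_conj[OF this ev]] show "b = ?b" by auto
  qed (rule ev)
qed

lemma phi_const_all:
  assumes "CHAR('k) > 0"
  shows "fold (phi_const' \<sigma>) indices (\<sigma> (mulop f)) =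
    mulop (Poly_Mapping.single 0 (Poly_Mapping.lookup f 0))"
proof -
  have "fold (phi_const' \<sigma>) is (\<sigma> (mulop f)) =
      \<sigma> (mulop (restr (\<lambda>m. \<forall>i\<in>set is. Poly_Mapping.lookup m i = 0) f))" for "is"
  proof (induction "is" arbitrary: f)
    case Nil
    have "restr (\<lambda>m. True) f = f" by (rule poly_mapping_eqI) (simp add: lookup_restr)
    then show ?case by simp
  next
    case (Cons i js)
    have "restr (\<lambda>m. \<forall>i\<in>set js. Poly_Mapping.lookup m i = 0)
          (restr (\<lambda>m. Poly_Mapping.lookup m i = 0) f) =
        restr (\<lambda>m. \<forall>i\<in>set (i # js). Poly_Mapping.lookup m i = 0) f"
      by (rule poly_mapping_eqI) (simp add: lookup_restr)
    then show ?case using Cons by (simp add: phi_const'[OF assms])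
  qed
  moreover have "restr (\<lambda>m. \<forall>i\<in>set indices. Poly_Mapping.lookup m i = 0) f =
      Poly_Mapping.single 0 (Poly_Mapping.lookup f 0)"
    by (rule poly_mapping_eqI) (auto simp: lookup_restr lookup_single when_def intro: poly_mapping_eqI)
  moreover have "mulop (Poly_Mapping.single 0 c) = (diffop_scale c 1 :: ('n, 'k) diffop)" for c
    by (simp add: diffop_scale_mult)
  ultimately show ?thesis by (simp add: scale one)
qed

lemma phi_full:
  assumes "CHAR('k) > 0"
  shows "phi_full \<sigma> (\<sigma> a) = mulop (Poly_Mapping.single 0 (Poly_Mapping.lookup (phi_poly a) 0))"
proof -
  have "fold (phi' \<sigma>) is (\<sigma> a) = \<sigma> (fold L.proj is a)" for "is" a
    by (induction "is" arbitrary: a) (simp_all add: phi')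
  moreover have "fold L.proj indices a = foldr L.proj indices a"
    by (rule foldr_fold[THEN fun_cong, symmetric]) (simp add: fun_eq_iff L.proj_proj)
  ultimately show ?thesis
    by (simp add: phi_full_def phi_all phi_const_all[OF assms])
qed

lemma psi_full:
  assumes "CHAR('k) > 0"
  shows "psi_full \<sigma> (\<sigma> a) = mulop (Poly_Mapping.single 0 (Poly_Mapping.lookup (apply_diffop a 1) 0))"
proof -
  have "foldr (psi' \<sigma>) is (\<sigma> a) = \<sigma> (foldr R.proj is a)" for "is"
    by (induction "is") (simp_all add: psi')
  then show ?thesis
    by (simp add: psi_full_def psi_all phi_const_all[OF assms])
qed

end

section \<open>The inversion formula\<close>

text \<open>
  If \<open>b\<close> is a finite sum of terms \<open>S \<beta> (r \<beta>)\<close> with \<open>S \<beta>\<close> additive, then expanding the polynomials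
  \<open>r \<beta>\<close> into monomials makes it a sum over pairs \<open>(\<alpha>, \<beta>)\<close>. It serves for \<open>S \<beta> f = \<partial>\<^bsup>[\<beta>]\<^esup> f\<close> and
  for \<open>S \<beta> f = f \<partial>\<^bsup>[\<beta>]\<^esup>\<close>.
\<close>

lemma has_finite_sum_coefficients:
  fixes r :: "('n::finite \<Rightarrow> nat) \<Rightarrow> ('n, 'k::field) mpoly" and S :: "('n \<Rightarrow> nat) \<Rightarrow> ('n, 'k) mpoly \<Rightarrow> 'b::comm_monoid_add"
  assumes "finite B" "\<And>\<beta>. \<beta> \<notin> B \<Longrightarrow> r \<beta> = 0"
    and S_add: "\<And>\<beta> f g. S \<beta> (f + g) = S \<beta> f + S \<beta> g" and S_zero: "\<And>\<beta>. S \<beta> 0 = 0"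
    and b: "b = (\<Sum>\<beta>\<in>B. S \<beta> (r \<beta>))"
  shows "has_finite_sum (\<lambda>(\<alpha>, \<beta>). S \<beta> (Poly_Mapping.single (exponent \<alpha>)
    (Poly_Mapping.lookup (r \<beta>) (exponent \<alpha>)))) b"
proof -
  let ?t = "\<lambda>\<alpha> \<beta>. Poly_Mapping.single (exponent \<alpha>) (Poly_Mapping.lookup (r \<beta>) (exponent \<alpha>))"
  define A where "A = (\<Union>\<beta>\<in>B. Poly_Mapping.lookup ` Poly_Mapping.keys (r \<beta>))"
  have "finite A" using assms(1) by (simp add: A_def)
  have A: "\<alpha> \<in> A \<and> \<beta> \<in> B" if "?t \<alpha> \<beta> \<noteq> 0" for \<alpha> \<beta>
  proof -
    have "exponent \<alpha> \<in> Poly_Mapping.keys (r \<beta>)" using that by (auto simp: in_keys_iff)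
    moreover from this have "\<beta> \<in> B" using assms(2) by fastforce
    moreover have "\<alpha> = Poly_Mapping.lookup (exponent \<alpha>)" by (simp add: lookup_exponent)
    ultimately show ?thesis unfolding A_def by blast
  qed
  have supp: "{x. (case x of (\<alpha>, \<beta>) \<Rightarrow> S \<beta> (?t \<alpha> \<beta>)) \<noteq> 0} \<subseteq> A \<times> B"
  proof -
    have "S \<beta> (?t \<alpha> \<beta>) = 0" if "\<not> (\<alpha> \<in> A \<and> \<beta> \<in> B)" for \<alpha> \<beta>
      using A[of \<alpha> \<beta>] that S_zero by metis
    then show ?thesis by auto
  qed
  have fin: "finite (A \<times> B)" using \<open>finite A\<close> assms(1) by simp
  have S_sum: "S \<beta> (sum f A) = (\<Sum>x\<in>A. S \<beta> (f x))" for \<beta> f and A :: "('n \<Rightarrow> nat) set"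
    by (induction A rule: infinite_finite_induct) (simp_all add: S_zero S_add)
  have expand: "r \<beta> = (\<Sum>\<alpha>\<in>A. ?t \<alpha> \<beta>)" if "\<beta> \<in> B" for \<beta>
  proof (rule poly_mapping_eqI)
    fix m :: "'n \<Rightarrow>\<^sub>0 nat"
    have eq_iff: "exponent \<alpha> = m \<longleftrightarrow> \<alpha> = Poly_Mapping.lookup m" for \<alpha>
      by (metis lookup_exponent lookup_inject)
    have exponent_lookup: "exponent (Poly_Mapping.lookup m) = m" by (simp add: eq_iff)
    have "Poly_Mapping.lookup (\<Sum>\<alpha>\<in>A. ?t \<alpha> \<beta>) m =
        (\<Sum>\<alpha>\<in>A. if \<alpha> = Poly_Mapping.lookup m then Poly_Mapping.lookup (r \<beta>) m else 0)"
      by (auto simp: lookup_sum lookup_single when_def eq_iff exponent_lookup intro!: sum.cong)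
    also have "\<dots> = Poly_Mapping.lookup (r \<beta>) m"
    proof -
      have "Poly_Mapping.lookup m \<in> A" if "m \<in> Poly_Mapping.keys (r \<beta>)"
        using that \<open>\<beta> \<in> B\<close> unfolding A_def by blast
      then show ?thesis using \<open>finite A\<close> by (auto simp: sum.delta in_keys_iff)
    qed
    finally show "Poly_Mapping.lookup (r \<beta>) m = Poly_Mapping.lookup (\<Sum>\<alpha>\<in>A. ?t \<alpha> \<beta>) m" ..
  qed
  have "Sum_any (\<lambda>(\<alpha>, \<beta>). S \<beta> (?t \<alpha> \<beta>)) = (\<Sum>(\<alpha>, \<beta>)\<in>A \<times> B. S \<beta> (?t \<alpha> \<beta>))"
    by (rule Sum_any.expand_superset[OF fin supp])
  also have "\<dots> = (\<Sum>\<beta>\<in>B. \<Sum>\<alpha>\<in>A. S \<beta> (?t \<alpha> \<beta>))"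
    by (subst sum.swap) (simp add: sum.cartesian_product)
  also have "\<dots> = b"
    unfolding b by (rule sum.cong[OF refl]) (subst expand, simp_all add: S_sum)
  finally show ?thesis
    unfolding has_finite_sum_def using finite_subset[OF supp fin] by simp
qed

lemma foldr_lmul_dpart:
  "foldr (\<lambda>i. lmul_dpart i (\<beta> i)) is a = prod_list (map (\<lambda>i. dpart i (\<beta> i)) is) * a"
  by (induction "is") (simp_all add: lmul_dpart_def mult.assoc)

lemma foldr_rmul_dpart:
  fixes a :: "('a, 'b::field) diffop"
  shows "foldr (\<lambda>i. rmul_dpart i (\<beta> i)) is a = a * prod_list (map (\<lambda>i. dpart i (\<beta> i)) is)"
proof (induction "is")
  case (Cons j js)
  have "prod_list (map (\<lambda>i. dpart i (\<beta> i)) js) * dpart j k =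
      (dpart j k * prod_list (map (\<lambda>i. dpart i (\<beta> i)) js) :: ('a, 'b) diffop)" for k
  proof (induction js)
    case (Cons l ls)
    then show ?case by (simp add: mult.assoc) (simp add: dpart_commute[of j k l] flip: mult.assoc)
  qed simp
  with Cons show ?case by (simp add: rmul_dpart_def mult.assoc)
qed simp

lemma foldr_del_eq_0:
  assumes "i \<in> set is" "(del i ^^ M) a = 0" "M \<le> \<beta> i"
  shows "foldr (\<lambda>i. del i ^^ \<beta> i) is a = 0"
proof -
  have swap: "(del i ^^ k) ((del j ^^ l) b) = (del j ^^ l) ((del i ^^ k) b)" for i j k l and b :: "('a, 'b) diffop"
  proof -
    have "del i ((del j ^^ l) b) = (del j ^^ l) (del i b)" for b :: "('a, 'b) diffop"
      by (induction l) (simp_all add: del_del[of i j])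
    then show ?thesis by (induction k) simp_all
  qed
  have "(del i ^^ \<beta> i) a = 0" using assms(2,3) by (rule L.E_funpow_eq_0_mono)
  with assms(1) show ?thesis
  proof (induction "is")
    case (Cons j js)
    have "(del i ^^ \<beta> i) (foldr (\<lambda>i. del i ^^ \<beta> i) js a) = foldr (\<lambda>i. del i ^^ \<beta> i) js ((del i ^^ \<beta> i) a)"
    proof (induction js)
      case (Cons l ls)
      then show ?case using swap[of "\<beta> i" i "\<beta> l" l] by simp
    qed simp
    moreover have "foldr (\<lambda>i. del i ^^ \<beta> i) js 0 = (0 :: ('a, 'b) diffop)"
      by (induction js) (simp_all add: L.E_funpow_zero)
    ultimately show ?case using Cons by (auto simp: L.E_funpow_zero)
  qed simp
qed

lemma del_nilpotent_uniform:
  "\<exists>M. \<forall>i. (del i ^^ M) (a :: ('n::finite, 'k::field) diffop) = 0"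
proof -
  obtain N where N: "(del i ^^ N i) a = 0" for i using del_nilpotent by metis
  have "(del i ^^ Max (range N)) a = 0" for i
    by (rule L.E_funpow_eq_0_mono[OF N]) simp
  then show ?thesis by blast
qed

theorem theorem7p2:
  fixes \<sigma> :: "('n::{finite, linorder}, 'k::field) diffop \<Rightarrow> ('n, 'k) diffop"
    and a :: "('n, 'k) diffop"
  assumes "CHAR('k) > 0"
    and "diffop_automorphism \<sigma>"
  shows "(has_finite_sum (\<lambda>(\<alpha>, \<beta>). (- 1) ^ (\<Sum>i\<in>UNIV. \<alpha> i) *
             phi_full \<sigma> (delta' \<sigma> \<beta> a * monom_dpart' \<sigma> \<alpha>) * (monom_dpart \<beta> * monom_dvar \<alpha>))
           (inv \<sigma> a)) \<and>
         (has_finite_sum (\<lambda>(\<alpha>, \<beta>).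
             psi_full \<sigma> (monom_dpart' \<sigma> \<alpha> * delta' \<sigma> \<beta> a) * (monom_dvar \<alpha> * monom_dpart \<beta>))
           (inv \<sigma> a))"
proof -
  interpret diffop_aut \<sigma> by standard (rule assms(2))
  define b where "b = inv \<sigma> a"
  have a: "a = \<sigma> b" using bij by (simp add: b_def bij_is_surj surj_f_inv_f)
  obtain M where M: "(del i ^^ M) b = 0" for i using del_nilpotent_uniform[of b] by blast
  define B where "B = Pi\<^sub>E (UNIV :: 'n set) (\<lambda>_. {..<M})"
  have "finite B" by (simp add: B_def finite_PiE)
  define d where "d \<beta> = foldr (\<lambda>i. del i ^^ \<beta> i) indices b" for \<beta>
  have d_zero: "d \<beta> = 0" if "\<beta> \<notin> B" for \<beta>
  proof -
    have "\<exists>i. M \<le> \<beta> i" using that by (auto simp: B_def PiE_UNIV_domain Pi_def not_less)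
    then obtain i where "M \<le> \<beta> i" ..
    then show ?thesis unfolding d_def by (intro foldr_del_eq_0[OF _ M, of i]) simp_all
  qed
  have delta: "delta' \<sigma> \<beta> a = \<sigma> (d \<beta>)" for \<beta>
    by (simp add: a delta' d_def)
  \<comment> \<open>Scalars are central, so a coefficient found by \<open>\<phi>\<^sub>\<sigma>\<close> can be moved to its monomial.\<close>
  have scalar: "mulop (Poly_Mapping.single 0 c) * (u * mulop (Poly_Mapping.single m 1)) =
      u * mulop (Poly_Mapping.single m c)" for c m and u :: "('n, 'k) diffop"
  proof -
    have "mulop (Poly_Mapping.single 0 c) * (u * mulop (Poly_Mapping.single m 1)) =
        u * (mulop (Poly_Mapping.single 0 c) * mulop (Poly_Mapping.single m 1))"
      by (simp add: mulop_scalar_commute[of c u] flip: mult.assoc)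
    then show ?thesis by (simp add: mult_single flip: mulop_mult)
  qed

  have phi_zero: "phi_poly 0 = (0 :: ('n, 'k) mpoly)"
  proof -
    have "foldr L.proj is 0 = (0 :: ('n, 'k) diffop)" for "is" :: "'n list"
      by (induction "is") (simp_all add: L.proj_zero)
    then show ?thesis by (simp add: phi_poly_def apply_simps)
  qed
  have "b = (\<Sum>\<beta>\<in>B. monom_dpart \<beta> * mulop (phi_poly (d \<beta>)))"
    using L.multi_taylor[of indices M b] M
    by (simp add: B_def d_def phi_all foldr_lmul_dpart monom_dpart_def)
  then have "has_finite_sum (\<lambda>(\<alpha>, \<beta>). monom_dpart \<beta> * mulop (Poly_Mapping.single (exponent \<alpha>)
      (Poly_Mapping.lookup (phi_poly (d \<beta>)) (exponent \<alpha>)))) b"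
    by (intro has_finite_sum_coefficients[OF \<open>finite B\<close>])
      (simp_all add: mulop_add mulop_0 distrib_left d_zero phi_zero)
  moreover have "(- 1) ^ (\<Sum>i\<in>UNIV. \<alpha> i) *
        phi_full \<sigma> (delta' \<sigma> \<beta> a * monom_dpart' \<sigma> \<alpha>) * (monom_dpart \<beta> * monom_dvar \<alpha>) =
      monom_dpart \<beta> * mulop (Poly_Mapping.single (exponent \<alpha>)
        (Poly_Mapping.lookup (phi_poly (d \<beta>)) (exponent \<alpha>)))" for \<alpha> \<beta>
  proof -
    have "phi_full \<sigma> (delta' \<sigma> \<beta> a * monom_dpart' \<sigma> \<alpha>) = phi_full \<sigma> (\<sigma> (d \<beta> * monom_dpart \<alpha>))"
      by (simp add: delta monom_dpart' mult)
    also have "\<dots> = mulop (Poly_Mapping.single 0 ((- 1) ^ (\<Sum>i\<in>UNIV. \<alpha> i) *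
        Poly_Mapping.lookup (phi_poly (d \<beta>)) (exponent \<alpha>)))"
      by (simp add: phi_full[OF assms(1)] coeff_phi)
    \<comment> \<open>The sign in the formula cancels the one from the right action of \<open>\<partial>\<^bsup>[\<alpha>]\<^esup>\<close>.\<close>
    finally have "(- 1) ^ (\<Sum>i\<in>UNIV. \<alpha> i) * phi_full \<sigma> (delta' \<sigma> \<beta> a * monom_dpart' \<sigma> \<alpha>) =
        mulop (Poly_Mapping.single 0 (Poly_Mapping.lookup (phi_poly (d \<beta>)) (exponent \<alpha>)))"
      by (cases "even (\<Sum>i\<in>UNIV. \<alpha> i)") (simp_all add: single_uminus mulop_minus)
    then show ?thesis by (simp add: monom_dvar_eq scalar)
  qed

  moreover have "b = (\<Sum>\<beta>\<in>B. mulop (apply_diffop (d \<beta>) 1) * monom_dpart \<beta>)"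
    using R.multi_taylor[of indices M b] M
    by (simp add: B_def d_def psi_all foldr_rmul_dpart monom_dpart_def)
  then have "has_finite_sum (\<lambda>(\<alpha>, \<beta>). mulop (Poly_Mapping.single (exponent \<alpha>)
      (Poly_Mapping.lookup (apply_diffop (d \<beta>) 1) (exponent \<alpha>))) * monom_dpart \<beta>) b"
    by (intro has_finite_sum_coefficients[OF \<open>finite B\<close>, where S = "\<lambda>\<beta> f. mulop f * monom_dpart \<beta>"])
      (simp_all add: mulop_add mulop_0 distrib_right d_zero apply_simps)
  moreover have "psi_full \<sigma> (monom_dpart' \<sigma> \<alpha> * delta' \<sigma> \<beta> a) * (monom_dvar \<alpha> * monom_dpart \<beta>) =
      mulop (Poly_Mapping.single (exponent \<alpha>)
        (Poly_Mapping.lookup (apply_diffop (d \<beta>) 1) (exponent \<alpha>))) * monom_dpart \<beta>" for \<alpha> \<beta>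
  proof -
    have "psi_full \<sigma> (monom_dpart' \<sigma> \<alpha> * delta' \<sigma> \<beta> a) = psi_full \<sigma> (\<sigma> (monom_dpart \<alpha> * d \<beta>))"
      by (simp add: delta monom_dpart' mult)
    also have "\<dots> = mulop (Poly_Mapping.single 0 (Poly_Mapping.lookup (apply_diffop (d \<beta>) 1) (exponent \<alpha>)))"
      by (simp add: psi_full[OF assms(1)] coeff_psi)
    finally show ?thesis
      by (simp add: monom_dvar_eq mult_single flip: mult.assoc mulop_mult)
  qed
  ultimately show ?thesis unfolding b_def by simp
qed

end
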